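(* Let $n\ge 3$ and $\mathbb{R}^n_+=\{x=(x',x_n)\in\mathbb{R}^n: x_n>0\}$. Let $u\in C^2(\mathbb{R}^n_+)\cap C(\overline{\mathbb{R}^n_+}\setminus\{0\})$ be a nonnegative solution of $$-\Delta u=n(n-2)\,u^{\frac{n+2}{n-2}}\quad\text{in }\mathbb{R}^n_+,\qquad u=0\quad\text{on }\partial\mathbb{R}^n_+\setminus\{0\}.$$ Suppose that $0$ is a non-removable singularity of $u$. Then $u$ depends only on $|x'|$ and $x_n$, and, writing $u=u(r,x_n)$ with $r=|x'|$, one has $\partial_r u(r,x_n)<0$ for all $r=|x'|>0$ (and $x_n>0$).
   Context: Here $x'=(x_1,\dots,x_{n-1})\in\mathbb{R}^{n-1}$. The point $0$ is a removable singularity of $u$ if $u$ extends to a continuous function at $0$ (on $\overline{\mathbb{R}^n_+}$); otherwise it is non-removable. No assumption is made on the behavior of $u$ at infinity. *)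

theory Defs
  imports "HOL-Analysis.Analysis"
begin

text \<open>
  Points of \<open>\<real>\<^sup>n\<close> are written as pairs \<open>x = (x', x\<^sub>n)\<close> with \<open>x' \<in> \<real>\<^sup>n\<^sup>-\<^sup>1\<close>; the product type
  carries the Euclidean norm and inner product, and its dimension is \<open>n = CARD('m) + 1\<close>.
\<close>

type_synonym 'm space = "(real ^ 'm) \<times> real"

definition half_space :: "('m::finite) space set" where
  "half_space = {x. snd x > 0}"

text \<open>
  The derivatives are the unrestricted ones (\<open>at x\<close>), so the next definition is the usual
  class \<open>C\<^sup>k(S)\<close> when \<open>S\<close> is open.
\<close>

fun Ck_on :: "nat \<Rightarrow> ('a::euclidean_space \<Rightarrow> real) \<Rightarrow> 'a set \<Rightarrow> bool" where
  "Ck_on 0 f S \<longleftrightarrow> continuous_on S f"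
| "Ck_on (Suc k) f S \<longleftrightarrow> (\<forall>x\<in>S. f differentiable (at x)) \<and>
     (\<forall>b\<in>Basis. Ck_on k (\<lambda>x. frechet_derivative f (at x) b) S)"

definition laplacian :: "('a::euclidean_space \<Rightarrow> real) \<Rightarrow> 'a \<Rightarrow> real" where
  "laplacian f x =
     (\<Sum>b\<in>Basis. frechet_derivative (\<lambda>y. frechet_derivative f (at y) b) (at x) b)"

text \<open>The value \<open>u 0\<close> of the total function \<open>u\<close> is irrelevant here.\<close>

definition removable_at_0 :: "(('m::finite) space \<Rightarrow> real) \<Rightarrow> bool" where
  "removable_at_0 u \<longleftrightarrow>
     (\<exists>v. continuous_on (closure half_space) v \<and> (\<forall>x \<in> closure half_space - {0}. v x = u x))"

end

theory Submission
  imports Defs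
begin

text \<open>
  Fix a unit vector \<open>e\<close> tangential to the boundary and \<open>a > 0\<close>. The Kelvin transform
  \<open>v z = |z| powr (2 - n) * u (a e + z / |z|\<^sup>2)\<close> centred at the regular boundary point \<open>a e\<close> solves
  the same equation; it decays like \<open>|z| powr (2 - n)\<close>, whatever \<open>u\<close> does at infinity, and its
  only singularities are \<open>0\<close> and \<open>- e / a\<close>. Planes orthogonal to \<open>e\<close> can therefore be moved from
  infinity up to the origin, and for \<open>v\<close> the last reflection is the reflection of \<open>u\<close> in the plane
  \<open>y \<bullet> e = a\<close>. Hence \<open>u\<close> increases under reflection in every such plane; \<open>a \<longlongrightarrow> 0\<close> with \<open>e\<close>
  and \<open>- e\<close> gives the symmetry, and Hopf's lemma the sign of the derivative.

  Regularity at the boundary is never needed: positive values of \<open>v - v\<^sub>t\<close>, with \<open>v\<^sub>t\<close> the reflected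
  function, are dominated by \<open>v\<close>, which vanishes at the flat boundary, also at the reflected
  singularities. Instead of Hopf's lemma at the corner, one explicit supersolution controls both
  infinity and the thin layers along the boundary.
\<close>

section \<open>Pointwise Laplacians\<close>

text \<open>Nothing is known about \<open>u\<close> at 0 or at infinity, so planes cannot be started
  for \<open>u\<close> itself, and inverting at 0 would merely exchange the two unknowns. Inverting
  at \<open>a e\<close> sends both to boundary points on the side
  \<open>x \<bullet> e \<le> 0\<close>, which no plane with \<open>t > 0\<close> passes. The price
  is that the reflected function may be singular at the boundary of the region beyond the plane.
  Estimates are therefore made where \<open>v\<close> exceeds its reflection: there the mean value
  theorem bounds the potential of the linearised equation by \<open>p * v powr (p - 1)\<close>,
  without the reflected value. The critical exponent enters twice: it makes the equation invariant
  under the Kelvin transform, and it makes \<open>v powr (p - 1)\<close> decay with exponent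
  \<open>- 4\<close>, so that the Hardy potential of exponent \<open>- 2\<close> wins far out.
  Non-removability enters through a single alternative. Exact symmetry in a plane would carry the
  singular point to a regular boundary point with value 0, forcing \<open>u\<close> to tend to 0 at
  the singularity. Hence the inequalities are strict by the strong maximum principle, which is what
  continuing the motion and Hopf's lemma require.\<close>

text \<open>Here \<open>d\<close> is the gradient of \<open>f\<close> at \<open>x\<close> and \<open>L\<close> the trace of the derivative of the gradient field.\<close>

definition has_lap :: "('a::euclidean_space \<Rightarrow> real) \<Rightarrow> 'a \<Rightarrow> real \<Rightarrow> 'a \<Rightarrow> bool" where
  "has_lap f d L x \<longleftrightarrow> (\<exists>g G. (\<forall>\<^sub>F y in nhds x. (f has_derivative (\<lambda>h. g y \<bullet> h)) (at y))
      \<and> g x = d \<and> (g has_derivative G) (at x) \<and> (\<Sum>b\<in>Basis. G b \<bullet> b) = L)"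

lemma has_lapI:
  assumes "\<forall>\<^sub>F y in nhds x. (f has_derivative (\<lambda>h. g y \<bullet> h)) (at y)"
    and "g x = d" "(g has_derivative G) (at x)" "(\<Sum>b\<in>Basis. G b \<bullet> b) = L"
  shows "has_lap f d L x"
  using assms unfolding has_lap_def by blast

lemma has_lapE:
  assumes "has_lap f d L x"
  obtains g G where "\<forall>\<^sub>F y in nhds x. (f has_derivative (\<lambda>h. g y \<bullet> h)) (at y)"
    and "g x = d" "(g has_derivative G) (at x)" "(\<Sum>b\<in>Basis. G b \<bullet> b) = L"
  using assms unfolding has_lap_def by blast

lemma has_lap_has_derivative:
  assumes "has_lap f d L x"
  shows "(f has_derivative (\<lambda>h. d \<bullet> h)) (at x)"
  using assms by (auto elim!: has_lapE dest!: eventually_nhds_x_imp_x)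

lemma has_lap_isCont: "has_lap f d L x \<Longrightarrow> isCont f x"
  using has_lap_has_derivative has_derivative_continuous by blast

lemma has_lap_const: "has_lap (\<lambda>_. k) 0 0 x"
  by (rule has_lapI[where g="\<lambda>_. 0" and G="\<lambda>_. 0"]) auto

lemma has_lap_linear: "has_lap (\<lambda>x. c \<bullet> x) c 0 x"
  by (rule has_lapI[where g="\<lambda>_. c" and G="\<lambda>_. 0"])
     (auto intro!: always_eventually derivative_eq_intros)

lemma has_lap_add:
  assumes "has_lap f d L x" "has_lap f' d' L' x"
  shows "has_lap (\<lambda>y. f y + f' y) (d + d') (L + L') x"
proof -
  obtain g G where g: "\<forall>\<^sub>F y in nhds x. (f has_derivative (\<lambda>h. g y \<bullet> h)) (at y)"
    "g x = d" "(g has_derivative G) (at x)" "(\<Sum>b\<in>Basis. G b \<bullet> b) = L"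
    using assms(1) by (rule has_lapE)
  obtain g' G' where g': "\<forall>\<^sub>F y in nhds x. (f' has_derivative (\<lambda>h. g' y \<bullet> h)) (at y)"
    "g' x = d'" "(g' has_derivative G') (at x)" "(\<Sum>b\<in>Basis. G' b \<bullet> b) = L'"
    using assms(2) by (rule has_lapE)
  show ?thesis
  proof (rule has_lapI)
    show "\<forall>\<^sub>F y in nhds x. ((\<lambda>y. f y + f' y) has_derivative (\<lambda>h. (g y + g' y) \<bullet> h)) (at y)"
      using g(1) g'(1) by eventually_elim (auto intro!: derivative_eq_intros simp: inner_add_left)
    show "((\<lambda>y. g y + g' y) has_derivative (\<lambda>h. G h + G' h)) (at x)"
      using g(3) g'(3) by (rule has_derivative_add)
  qed (use g g' in \<open>auto simp: inner_add_left sum.distrib\<close>)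
qed

text \<open>The two derivative hypotheses follow the shape of \<open>has_lap\<close>: the gradient
  field \<open>F' (f y) *\<^sub>R g y\<close> must exist near \<open>x\<close>, while it is
  differentiated only at \<open>x\<close>.\<close>

lemma has_lap_compose:
  fixes F F' :: "real \<Rightarrow> real"
  assumes f: "has_lap f d L x"
    and F: "\<forall>\<^sub>F s in nhds (f x). (F has_real_derivative F' s) (at s)"
    and F': "(F' has_real_derivative F'') (at (f x))"
  shows "has_lap (\<lambda>y. F (f y)) (F' (f x) *\<^sub>R d) (F'' * (d \<bullet> d) + F' (f x) * L) x"
proof -
  obtain g G where g: "\<forall>\<^sub>F y in nhds x. (f has_derivative (\<lambda>h. g y \<bullet> h)) (at y)"
    "g x = d" "(g has_derivative G) (at x)" "(\<Sum>b\<in>Basis. G b \<bullet> b) = L"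
    using f by (rule has_lapE)
  have cont: "filterlim f (nhds (f x)) (nhds x)"
    using has_lap_isCont[OF f] by (simp add: isCont_def tendsto_nhds_iff)
  have fx: "(f has_derivative (\<lambda>h. d \<bullet> h)) (at x)"
    by (rule has_lap_has_derivative[OF f])
  show ?thesis
  proof (rule has_lapI)
    show "\<forall>\<^sub>F y in nhds x. ((\<lambda>y. F (f y)) has_derivative (\<lambda>h. (F' (f y) *\<^sub>R g y) \<bullet> h)) (at y)"
      using g(1) eventually_compose_filterlim[OF F cont]
    proof eventually_elim
      case (elim y)
      show ?case
        using has_derivative_compose[OF elim(1) elim(2)[unfolded has_field_derivative_def]] by simp
    qed
    show "((\<lambda>y. F' (f y) *\<^sub>R g y) has_derivative
        (\<lambda>h. F' (f x) *\<^sub>R G h + (F'' * (d \<bullet> h)) *\<^sub>R g x)) (at x)"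
      using has_derivative_scaleR[OF has_derivative_compose[OF fx F'[unfolded has_field_derivative_def]] g(3)]
      by simp
    have "(\<Sum>b\<in>Basis. (d \<bullet> b) * (d \<bullet> b)) = d \<bullet> d"
      by (rule euclidean_inner[symmetric])
    then show "(\<Sum>b\<in>Basis. (F' (f x) *\<^sub>R G b + (F'' * (d \<bullet> b)) *\<^sub>R g x) \<bullet> b)
        = F'' * (d \<bullet> d) + F' (f x) * L"
      using g(2,4) by (simp add: inner_add_left sum.distrib sum_distrib_left[symmetric] mult.assoc)
  qed (use g in auto)
qed

lemma has_lap_mult:
  assumes "has_lap f d L x" "has_lap f' d' L' x"
  shows "has_lap (\<lambda>y. f y * f' y) (f x *\<^sub>R d' + f' x *\<^sub>R d) (f x * L' + f' x * L + 2 * (d \<bullet> d')) x"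
proof -
  obtain g G where g: "\<forall>\<^sub>F y in nhds x. (f has_derivative (\<lambda>h. g y \<bullet> h)) (at y)"
    "g x = d" "(g has_derivative G) (at x)" "(\<Sum>b\<in>Basis. G b \<bullet> b) = L"
    using assms(1) by (rule has_lapE)
  obtain g' G' where g': "\<forall>\<^sub>F y in nhds x. (f' has_derivative (\<lambda>h. g' y \<bullet> h)) (at y)"
    "g' x = d'" "(g' has_derivative G') (at x)" "(\<Sum>b\<in>Basis. G' b \<bullet> b) = L'"
    using assms(2) by (rule has_lapE)
  note fx = has_lap_has_derivative[OF assms(1)] has_lap_has_derivative[OF assms(2)]
  show ?thesis
  proof (rule has_lapI)
    show "\<forall>\<^sub>F y in nhds x. ((\<lambda>y. f y * f' y) has_derivative
        (\<lambda>h. (f y *\<^sub>R g' y + f' y *\<^sub>R g y) \<bullet> h)) (at y)"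
      using g(1) g'(1) by eventually_elim (auto intro!: derivative_eq_intros simp: inner_add_left)
    show "((\<lambda>y. f y *\<^sub>R g' y + f' y *\<^sub>R g y) has_derivative
        (\<lambda>h. (f x *\<^sub>R G' h + (d \<bullet> h) *\<^sub>R g' x) + (f' x *\<^sub>R G h + (d' \<bullet> h) *\<^sub>R g x))) (at x)"
      by (intro has_derivative_add has_derivative_scaleR fx g g')
    have "(\<Sum>b\<in>Basis. (d \<bullet> b) * (d' \<bullet> b)) = d \<bullet> d'"
      by (rule euclidean_inner[symmetric])
    moreover have "(\<Sum>b\<in>Basis. (d' \<bullet> b) * (d \<bullet> b)) = d \<bullet> d'"
      by (subst inner_commute) (rule euclidean_inner[symmetric])
    ultimately show "(\<Sum>b\<in>Basis. ((f x *\<^sub>R G' b + (d \<bullet> b) *\<^sub>R g' x) + (f' x *\<^sub>R G b + (d' \<bullet> b) *\<^sub>R g x)) \<bullet> b)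
        = f x * L' + f' x * L + 2 * (d \<bullet> d')"
      using g(2,4) g'(2,4) by (simp add: inner_add_left sum.distrib sum_distrib_left[symmetric])
  qed (use g g' in auto)
qed

lemma has_lap_cmult: "has_lap f d L x \<Longrightarrow> has_lap (\<lambda>y. k * f y) (k *\<^sub>R d) (k * L) x"
  using has_lap_mult[OF has_lap_const[of k]] by fastforce

lemma has_lap_diff:
  assumes "has_lap f d L x" "has_lap f' d' L' x"
  shows "has_lap (\<lambda>y. f y - f' y) (d - d') (L - L') x"
  using has_lap_add[OF assms(1) has_lap_cmult[OF assms(2), of "-1"]] by simp

text \<open>The norm is treated as a power of the polynomial
  \<open>(x - c) \<bullet> (x - c)\<close>, to which the chain rule applies away from
  \<open>c\<close>. With \<open>n\<close> the dimension, the coefficient vanishes for exponent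
  \<open>2 - n\<close> (Kelvin weight), is positive for \<open>- n\<close> (barrier) and is most
  negative for \<open>- (n - 2) / 2\<close> (Hardy weight).\<close>

lemma has_lap_norm_powr:
  fixes c :: "'a::euclidean_space"
  assumes "x \<noteq> c"
  shows "has_lap (\<lambda>x. norm (x - c) powr \<beta>) ((\<beta> * norm (x - c) powr (\<beta> - 2)) *\<^sub>R (x - c))
           (\<beta> * (\<beta> + real DIM('a) - 2) * norm (x - c) powr (\<beta> - 2)) x"
proof -
  have q: "has_lap (\<lambda>x. (x - c) \<bullet> (x - c)) (2 *\<^sub>R (x - c)) (2 * real DIM('a)) x"
  proof (rule has_lapI)
    show "\<forall>\<^sub>F y in nhds x. ((\<lambda>x. (x - c) \<bullet> (x - c)) has_derivative (\<lambda>h. (2 *\<^sub>R (y - c)) \<bullet> h)) (at y)"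
      by (auto intro!: always_eventually derivative_eq_intros simp: inner_commute)
    show "((\<lambda>y. 2 *\<^sub>R (y - c)) has_derivative (\<lambda>h. 2 *\<^sub>R h)) (at x)"
      by (auto intro!: derivative_eq_intros)
  qed auto
  let ?s = "(x - c) \<bullet> (x - c)"
  have pos: "?s > 0" using assms by simp
  have ev: "\<forall>\<^sub>F s in nhds ?s. s > (0::real)"
    using pos by (intro order_tendstoD(1)[OF filterlim_ident])
  have F: "\<forall>\<^sub>F s in nhds ?s. ((\<lambda>s. s powr (\<beta>/2)) has_real_derivative (\<beta>/2) * s powr (\<beta>/2 - 1)) (at s)"
    using ev by eventually_elim (rule has_real_derivative_powr)
  have F': "((\<lambda>s. (\<beta>/2) * s powr (\<beta>/2 - 1)) has_real_derivative
      (\<beta>/2) * ((\<beta>/2 - 1) * ?s powr (\<beta>/2 - 1 - 1))) (at ?s)"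
    by (rule DERIV_cmult[OF has_real_derivative_powr[OF pos]])
  note L = has_lap_compose[OF q F F']
  have np: "norm y powr \<gamma> = (y \<bullet> y) powr (\<gamma>/2)" for y :: 'a and \<gamma>
    by (simp add: norm_eq_sqrt_inner powr_half_sqrt[symmetric] powr_powr)
  have s1: "?s powr (\<beta>/2 - 1 - 1) * ?s = ?s powr (\<beta>/2 - 1)"
    using pos powr_add[of ?s "\<beta>/2 - 1 - 1" 1] by (simp add: powr_one)
  have ring: "(\<beta>/2) * ((\<beta>/2 - 1) * A) * (2 * (2 * q)) + (\<beta>/2) * (A * q) * (2 * m)
      = \<beta> * (\<beta> + m - 2) * (A * q)" for A q m :: real
    by (simp add: field_simps)
  have "(\<beta>/2) * ((\<beta>/2 - 1) * ?s powr (\<beta>/2 - 1 - 1)) * ((2 *\<^sub>R (x - c)) \<bullet> (2 *\<^sub>R (x - c)))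
      + (\<beta>/2) * ?s powr (\<beta>/2 - 1) * (2 * real DIM('a))
      = \<beta> * (\<beta> + real DIM('a) - 2) * ?s powr (\<beta>/2 - 1)"
    unfolding s1[symmetric] inner_scaleR_left inner_scaleR_right by (rule ring)
  moreover have "\<beta>/2 * ?s powr (\<beta>/2 - 1) * 2 = \<beta> * ?s powr (\<beta>/2 - 1)"
    by simp
  moreover have "(\<beta> - 2)/2 = \<beta>/2 - 1" by simp
  ultimately show ?thesis
    using L unfolding np by (simp only: scaleR_scaleR)
qed

lemma has_lap_exp_linear:
  assumes "norm c = 1"
  shows "has_lap (\<lambda>x. exp (- l * (c \<bullet> x - t))) (- (l * exp (- l * (c \<bullet> x - t))) *\<^sub>R c)
    (l\<^sup>2 * exp (- l * (c \<bullet> x - t))) x"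
proof -
  have 1: "((\<lambda>s. exp (- l * (s - t))) has_real_derivative - (l * exp (- l * (s - t)))) (at s)" for s
    by (auto intro!: derivative_eq_intros)
  have 2: "((\<lambda>s. - (l * exp (- l * (s - t)))) has_real_derivative l\<^sup>2 * exp (- l * (s - t))) (at s)" for s
    by (auto intro!: derivative_eq_intros simp: power2_eq_square)
  have "c \<bullet> c = 1" using assms by (simp add: dot_square_norm)
  then show ?thesis
    using has_lap_compose[OF has_lap_linear[of c x], of "\<lambda>s. exp (- l * (s - t))", OF _ 2] 1 by auto
qed

text \<open>For a unit vector \<open>e\<close>, the reflection in the hyperplane
  \<open>x \<bullet> e = t\<close>.\<close>

definition mirror :: "'a::euclidean_space \<Rightarrow> real \<Rightarrow> 'a \<Rightarrow> 'a" where
  "mirror e t x = x + (2 * (t - x \<bullet> e)) *\<^sub>R e"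

text \<open>The linear part \<open>R0\<close> of the reflection is an orthogonal involution, so the
  derivative of the gradient becomes \<open>R0 G R0\<close>, which has the trace of
  \<open>G\<close>.\<close>

lemma has_lap_mirror:
  assumes e: "norm e = 1" and f: "has_lap f d L (mirror e t x)"
  shows "has_lap (\<lambda>y. f (mirror e t y)) (d - (2 * (d \<bullet> e)) *\<^sub>R e) L x"
proof -
  obtain g G where g: "\<forall>\<^sub>F y in nhds (mirror e t x). (f has_derivative (\<lambda>h. g y \<bullet> h)) (at y)"
    "g (mirror e t x) = d" "(g has_derivative G) (at (mirror e t x))" "(\<Sum>b\<in>Basis. G b \<bullet> b) = L"
    using f by (rule has_lapE)
  have ee: "e \<bullet> e = 1" using e by (simp add: dot_square_norm)
  define R0 where "R0 h = h - (2 * (h \<bullet> e)) *\<^sub>R e" for h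
  have R: "(mirror e t has_derivative R0) (at y)" for y
    unfolding mirror_def R0_def by (auto intro!: derivative_eq_intros simp: algebra_simps)
  have lim: "filterlim (mirror e t) (nhds (mirror e t x)) (nhds x)"
    using has_derivative_continuous[OF R, of x] by (simp add: isCont_def tendsto_nhds_iff)
  interpret G: linear G using g(3) by (rule has_derivative_linear)
  show ?thesis
  proof (rule has_lapI)
    show "\<forall>\<^sub>F y in nhds x. ((\<lambda>y. f (mirror e t y)) has_derivative (\<lambda>h. R0 (g (mirror e t y)) \<bullet> h)) (at y)"
      using eventually_compose_filterlim[OF g(1) lim]
    proof eventually_elim
      case (elim y)
      have "(\<lambda>h. g (mirror e t y) \<bullet> R0 h) = (\<lambda>h. R0 (g (mirror e t y)) \<bullet> h)"
        by (auto simp: R0_def inner_diff_left inner_diff_right inner_commute)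
      then show ?case using has_derivative_compose[OF R elim] by simp
    qed
    show "((\<lambda>y. R0 (g (mirror e t y))) has_derivative (\<lambda>h. R0 (G (R0 h)))) (at x)"
      unfolding R0_def[of "g _"] R0_def[of "G _"]
      using has_derivative_compose[OF R g(3)] by (auto intro!: derivative_eq_intros)
    \<comment> \<open>After summation the three correction terms are \<open>- 2\<close>,
      \<open>- 2\<close> and \<open>4\<close> times \<open>G e \<bullet> e\<close> and
      cancel.\<close>
    have "R0 (G (R0 b)) \<bullet> b = G b \<bullet> b - 2 * ((G e \<bullet> b) * (e \<bullet> b)) - 2 * ((e \<bullet> b) * (G b \<bullet> e))
        + 4 * (G e \<bullet> e) * ((e \<bullet> b) * (e \<bullet> b))" for b
      by (simp add: R0_def G.diff G.scaleR inner_diff_left inner_diff_right inner_commute algebra_simps)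
    moreover have "(\<Sum>b\<in>Basis. (G e \<bullet> b) * (e \<bullet> b)) = G e \<bullet> e" "(\<Sum>b\<in>Basis. (e \<bullet> b) * (e \<bullet> b)) = 1"
      using ee by (simp_all only: euclidean_inner[symmetric])
    moreover have "(\<Sum>b\<in>Basis. (e \<bullet> b) * (G b \<bullet> e)) = G e \<bullet> e"
    proof -
      have "G e = G (\<Sum>b\<in>Basis. (e \<bullet> b) *\<^sub>R b)" by (simp add: euclidean_representation)
      then show ?thesis by (simp add: G.sum G.scaleR inner_sum_left)
    qed
    ultimately show "(\<Sum>b\<in>Basis. R0 (G (R0 b)) \<bullet> b) = L"
      by (simp add: sum.distrib sum_subtractf sum_distrib_left[symmetric] g(4))
  qed (use g in \<open>auto simp: R0_def\<close>)
qed

text \<open>Argued on each coordinate line: the first derivative vanishes at \<open>x\<close>, and a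
  positive diagonal entry of \<open>G\<close> would make it positive just to the right, so that
  \<open>f\<close> would increase strictly away from its maximum.\<close>

lemma has_lap_local_max:
  assumes f: "has_lap f d L x" and max: "\<forall>\<^sub>F y in nhds x. f y \<le> f x"
  shows "L \<le> 0"
proof -
  obtain g G where g: "\<forall>\<^sub>F y in nhds x. (f has_derivative (\<lambda>h. g y \<bullet> h)) (at y)"
    "g x = d" "(g has_derivative G) (at x)" "(\<Sum>b\<in>Basis. G b \<bullet> b) = L"
    using f by (rule has_lapE)
  obtain r where r: "r > 0" "\<And>y. dist y x < r \<Longrightarrow> (f has_derivative (\<lambda>h. g y \<bullet> h)) (at y) \<and> f y \<le> f x"
    using eventually_conj[OF g(1) max] unfolding eventually_nhds_metric by auto
  interpret G: bounded_linear G using g(3) by (rule has_derivative_bounded_linear)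
  have "G b \<bullet> b \<le> 0" if b: "b \<in> Basis" for b
  proof (rule ccontr)
    assume "\<not> G b \<bullet> b \<le> 0"
    then have pos: "G b \<bullet> b > 0" by simp
    define \<phi> where "\<phi> s = f (x + s *\<^sub>R b)" for s
    define \<gamma> where "\<gamma> s = g (x + s *\<^sub>R b) \<bullet> b" for s
    have \<phi>: "(\<phi> has_real_derivative \<gamma> s) (at s)" if "\<bar>s\<bar> < r" for s
    proof -
      have "dist (x + s *\<^sub>R b) x < r" using that b by (simp add: dist_norm)
      then have "(f has_derivative (\<lambda>h. g (x + s *\<^sub>R b) \<bullet> h)) (at (x + s *\<^sub>R b))" using r by blast
      moreover have "((\<lambda>s. x + s *\<^sub>R b) has_derivative (\<lambda>h. h *\<^sub>R b)) (at s)"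
        by (auto intro!: derivative_eq_intros)
      moreover have "(\<lambda>h. g (x + s *\<^sub>R b) \<bullet> (h *\<^sub>R b)) = (*) (g (x + s *\<^sub>R b) \<bullet> b)"
        by (auto simp: mult.commute)
      ultimately show ?thesis
        unfolding \<phi>_def \<gamma>_def has_field_derivative_def
        using has_derivative_compose by metis
    qed
    have "((\<lambda>s. x + s *\<^sub>R b) has_derivative (\<lambda>h. h *\<^sub>R b)) (at 0)"
      by (auto intro!: derivative_eq_intros)
    from has_derivative_compose[OF this, of g G] g(3)
    have "((\<lambda>s. g (x + s *\<^sub>R b)) has_derivative (\<lambda>h. h *\<^sub>R G b)) (at 0)"
      by (simp add: G.scaleR)
    then have \<gamma>: "(\<gamma> has_real_derivative G b \<bullet> b) (at 0)"
      unfolding \<gamma>_def has_field_derivative_def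
      by (auto intro!: derivative_eq_intros simp: mult.commute)
    have "\<gamma> 0 = 0"
      using DERIV_local_max[OF \<phi>[of 0], of r] r
      by (auto simp: \<phi>_def dist_norm b)
    then obtain d' where d': "d' > 0" "\<And>h. 0 < h \<Longrightarrow> h < d' \<Longrightarrow> \<gamma> h > 0"
      using DERIV_pos_inc_right[OF \<gamma> pos] by auto
    define s where "s = min (r/2) (d'/2)"
    have s: "0 < s" "s < r" "s < d'" using r d' by (auto simp: s_def)
    have "\<phi> 0 < \<phi> s"
    proof (rule DERIV_pos_imp_increasing_open[OF s(1)])
      fix y assume "0 < y" "y < s"
      then show "\<exists>z. (\<phi> has_real_derivative z) (at y) \<and> 0 < z"
        using \<phi>[of y] d'(2)[of y] s by auto
    next
      show "continuous_on {0..s} \<phi>"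
        using s by (intro DERIV_atLeastAtMost_imp_continuous_on[of _ _ \<phi>]) (auto intro!: exI \<phi>)
    qed
    moreover have "dist (x + s *\<^sub>R b) x < r" using s b by (simp add: dist_norm)
    ultimately show False using r(2)[of "x + s *\<^sub>R b"] by (simp add: \<phi>_def)
  qed
  then have "(\<Sum>b\<in>Basis. G b \<bullet> b) \<le> 0" by (rule sum_nonpos)
  then show ?thesis by (simp only: g(4))
qed

text \<open>The derivative of the inversion is \<open>i\<close> times the reflection in the
  hyperplane orthogonal to \<open>z\<close>, whence the factor \<open>i\<^sup>2\<close> at
  \<open>L\<close>. The first-order term is \<open>d\<close> paired with the Laplacian of the
  inversion itself, which is \<open>(4 - 2 * n) * i\<^sup>2\<close> times \<open>z\<close> in
  dimension \<open>n\<close>.\<close>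

lemma has_lap_inversion:
  fixes z p :: "'a::euclidean_space"
  assumes z: "z \<noteq> 0" and u: "has_lap u d L (p + z /\<^sub>R (z \<bullet> z))"
  defines "i \<equiv> inverse (z \<bullet> z)"
  shows "has_lap (\<lambda>y. u (p + y /\<^sub>R (y \<bullet> y))) (i *\<^sub>R d - (2 * i\<^sup>2 * (z \<bullet> d)) *\<^sub>R z)
           (i\<^sup>2 * L + i\<^sup>2 * (4 - 2 * real DIM('a)) * (z \<bullet> d)) z"
proof -
  define T where "T y = p + y /\<^sub>R (y \<bullet> y)" for y
  obtain g G where g: "\<forall>\<^sub>F y in nhds (T z). (u has_derivative (\<lambda>h. g y \<bullet> h)) (at y)"
    "g (T z) = d" "(g has_derivative G) (at (T z))" "(\<Sum>b\<in>Basis. G b \<bullet> b) = L"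
    using u unfolding T_def by (rule has_lapE)
  interpret G: linear G using g(3) by (rule has_derivative_linear)
  define j where "j y = inverse (y \<bullet> y)" for y :: 'a
  define j' where "j' y h = - 2 * (y \<bullet> h) * (j y)\<^sup>2" for y h
  have j: "(j has_derivative j' y) (at y)" if "y \<noteq> 0" for y
    using that unfolding j_def j'_def
    by (auto intro!: derivative_eq_intros simp: fun_eq_iff inner_commute power2_eq_square)
  define T' where "T' y h = j y *\<^sub>R h + j' y h *\<^sub>R y" for y h
  have T: "(T has_derivative T' y) (at y)" if "y \<noteq> 0" for y
    using j[OF that] unfolding T_def T'_def j_def[symmetric]
    by (auto intro!: derivative_eq_intros)
  have nz: "\<forall>\<^sub>F y in nhds z. y \<noteq> 0"
    using z by (rule t1_space_nhds)
  have lim: "filterlim T (nhds (T z)) (nhds z)"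
    using has_derivative_continuous[OF T[OF z]] by (simp add: isCont_def tendsto_nhds_iff)
  define \<gamma> where "\<gamma> y = g (T y)" for y
  define \<Gamma> where "\<Gamma> h = G (T' z h)" for h
  have \<gamma>: "(\<gamma> has_derivative \<Gamma>) (at z)"
    unfolding \<gamma>_def \<Gamma>_def by (rule has_derivative_compose[OF T[OF z] g(3)])
  define F where "F y = j y *\<^sub>R \<gamma> y - (2 * (j y)\<^sup>2 * (y \<bullet> \<gamma> y)) *\<^sub>R y" for y
  define F' where "F' h = j z *\<^sub>R \<Gamma> h + j' z h *\<^sub>R \<gamma> z - ((2 * (j z)\<^sup>2 * (z \<bullet> \<gamma> z)) *\<^sub>R h +
     (4 * j z * j' z h * (z \<bullet> \<gamma> z) + 2 * (j z)\<^sup>2 * (h \<bullet> \<gamma> z + z \<bullet> \<Gamma> h)) *\<^sub>R z)" for h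
  have jz: "j z = i" "i * (z \<bullet> z) = 1" using z by (auto simp: j_def i_def)
  have sums: "(\<Sum>b\<in>Basis. (x \<bullet> b) * (y \<bullet> b)) = x \<bullet> y" for x y :: 'a
    by (rule euclidean_inner[symmetric])
  have Gz: "(\<Sum>b\<in>Basis. (z \<bullet> G b) * (z \<bullet> b)) = z \<bullet> G z"
  proof -
    have "G z = G (\<Sum>b\<in>Basis. (z \<bullet> b) *\<^sub>R b)" by (simp add: euclidean_representation)
    then show ?thesis by (simp add: G.sum G.scaleR inner_sum_right mult.commute)
  qed
  have \<Gamma>b: "\<Gamma> b = i *\<^sub>R G b - (2 * i\<^sup>2 * (z \<bullet> b)) *\<^sub>R G z" for b
    by (simp add: \<Gamma>_def T'_def j'_def jz G.add G.diff G.scaleR mult.commute mult.left_commute)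
  have tr\<Gamma>: "(\<Sum>b\<in>Basis. \<Gamma> b \<bullet> b) = i * L - 2 * i\<^sup>2 * (z \<bullet> G z)"
    using sums[of z "G z"]
    by (simp add: \<Gamma>b inner_diff_left sum_subtractf sum_distrib_left[symmetric] g(4) mult.assoc)
  have "(\<Sum>b\<in>Basis. (z \<bullet> \<Gamma> b) * (z \<bullet> b)) = i * (z \<bullet> G z) - 2 * i * (i * (z \<bullet> z)) * (z \<bullet> G z)"
  proof -
    have "(z \<bullet> \<Gamma> b) * (z \<bullet> b) = i * ((z \<bullet> G b) * (z \<bullet> b)) - 2 * i\<^sup>2 * (z \<bullet> G z) * ((z \<bullet> b) * (z \<bullet> b))" for b
      by (simp add: \<Gamma>b inner_diff_right algebra_simps)
    then show ?thesis
      by (simp add: sum_subtractf sum_distrib_left[symmetric] Gz sums power2_eq_square)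
  qed
  then have z\<Gamma>: "(\<Sum>b\<in>Basis. (z \<bullet> \<Gamma> b) * (z \<bullet> b)) = - i * (z \<bullet> G z)"
    by (simp add: jz)
  show ?thesis
    unfolding T_def[symmetric]
  proof (rule has_lapI)
    show "\<forall>\<^sub>F y in nhds z. ((\<lambda>y. u (T y)) has_derivative (\<lambda>h. F y \<bullet> h)) (at y)"
      using eventually_compose_filterlim[OF g(1) lim] nz
    proof eventually_elim
      case (elim y)
      have "(\<lambda>h. g (T y) \<bullet> T' y h) = (\<lambda>h. F y \<bullet> h)"
        by (simp add: fun_eq_iff T'_def F_def j'_def \<gamma>_def inner_add_right inner_diff_left
            inner_commute[of "g (T y)" y] algebra_simps)
      then show ?case using has_derivative_compose[OF T[OF elim(2)] elim(1)] by simp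
    qed
    show "(F has_derivative F') (at z)"
      unfolding F_def F'_def
      by (rule derivative_eq_intros \<gamma> j z refl)+
         (simp add: fun_eq_iff algebra_simps power2_eq_square)
    have F'b: "F' b \<bullet> b = i * (\<Gamma> b \<bullet> b) - 2 * i\<^sup>2 * ((z \<bullet> b) * (d \<bullet> b)) - 2 * i\<^sup>2 * (z \<bullet> d) * (b \<bullet> b)
      + 8 * i ^ 3 * (z \<bullet> d) * ((z \<bullet> b) * (z \<bullet> b)) - 2 * i\<^sup>2 * ((d \<bullet> b) * (z \<bullet> b))
      - 2 * i\<^sup>2 * ((z \<bullet> \<Gamma> b) * (z \<bullet> b))" for b
      by (simp add: F'_def j'_def jz \<gamma>_def g(2) inner_add_left inner_diff_left algebra_simps
          power2_eq_square power3_eq_cube inner_commute[of b d])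
    have "(\<Sum>b\<in>Basis. F' b \<bullet> b) = i * (i * L - 2 * i\<^sup>2 * (z \<bullet> G z)) - 2 * i\<^sup>2 * (z \<bullet> d)
       - 2 * i\<^sup>2 * (z \<bullet> d) * real DIM('a) + 8 * i\<^sup>2 * (z \<bullet> d) * (i * (z \<bullet> z))
       - 2 * i\<^sup>2 * (z \<bullet> d) - 2 * i\<^sup>2 * (- i * (z \<bullet> G z))"
      unfolding F'b sum.distrib sum_subtractf sum_distrib_left[symmetric] tr\<Gamma> z\<Gamma> sums
      by (simp add: inner_commute power2_eq_square power3_eq_cube)
    also have "\<dots> = i\<^sup>2 * L + i\<^sup>2 * (4 - 2 * real DIM('a)) * (z \<bullet> d)"
      unfolding jz by (simp add: algebra_simps power2_eq_square)
    finally show "(\<Sum>b\<in>Basis. F' b \<bullet> b) = i\<^sup>2 * L + i\<^sup>2 * (4 - 2 * real DIM('a)) * (z \<bullet> d)" .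
    show "F z = i *\<^sub>R d - (2 * i\<^sup>2 * (z \<bullet> d)) *\<^sub>R z"
      by (simp add: F_def jz \<gamma>_def g(2))
  qed
qed

text \<open>The weight is harmonic, and its cross term in the product rule is exactly opposite to
  the first-order term produced by the inversion.\<close>

lemma has_lap_kelvin:
  fixes z p :: "'a::euclidean_space"
  assumes z: "z \<noteq> 0" and u: "has_lap u d L (p + z /\<^sub>R (z \<bullet> z))"
  defines "n \<equiv> real DIM('a)"
  shows "\<exists>d. has_lap (\<lambda>y. norm y powr (2 - n) * u (p + y /\<^sub>R (y \<bullet> y))) d (norm z powr (- 2 - n) * L) z"
proof -
  define i where "i = inverse (z \<bullet> z)"
  have i: "norm z powr (2 - n - 2) = i * norm z powr (2 - n)"
      "norm z powr (- 2 - n) = i\<^sup>2 * norm z powr (2 - n)" "i * (z \<bullet> z) = 1"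
  proof -
    have zz: "z \<bullet> z = norm z powr 2" using z by (simp add: dot_square_norm)
    have "i = norm z powr (-2)" unfolding i_def zz by (simp only: powr_minus)
    then show "norm z powr (2 - n - 2) = i * norm z powr (2 - n)"
      "norm z powr (- 2 - n) = i\<^sup>2 * norm z powr (2 - n)"
      by (simp_all add: powr_add[symmetric] power2_eq_square)
  qed (use z in \<open>auto simp: i_def\<close>)
  have 1: "has_lap (\<lambda>y. norm y powr (2 - n)) (((2 - n) * norm z powr (2 - n - 2)) *\<^sub>R z) 0 z"
    using has_lap_norm_powr[of z 0 "2 - n"] z by (simp add: n_def)
  have "(norm z powr (2 - n)) * (i\<^sup>2 * L + i\<^sup>2 * (4 - 2 * n) * (z \<bullet> d))
     + u (p + z /\<^sub>R (z \<bullet> z)) * 0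
     + 2 * ((((2 - n) * norm z powr (2 - n - 2)) *\<^sub>R z) \<bullet> (i *\<^sub>R d - (2 * i\<^sup>2 * (z \<bullet> d)) *\<^sub>R z))
     = norm z powr (2 - n) * i\<^sup>2 * L + norm z powr (2 - n) * ((4 - 2 * n) * i\<^sup>2 * (z \<bullet> d)
       + 2 * (2 - n) * (i\<^sup>2 * (z \<bullet> d) - 2 * i\<^sup>2 * (z \<bullet> d) * (i * (z \<bullet> z))))"
    unfolding i(1) by (simp add: inner_diff_right algebra_simps power2_eq_square)
  also have "\<dots> = norm z powr (- 2 - n) * L"
    unfolding i(2,3) by (simp add: algebra_simps)
  finally show ?thesis
    using has_lap_mult[OF 1 has_lap_inversion[OF z u]] unfolding i_def n_def by auto
qed

text \<open>Bridge from iterated Frechet derivatives to \<open>has_lap\<close>: the gradient field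
  is assembled from the partial derivatives, each of which is again differentiable on the open
  set.\<close>

lemma laplacian_Ck_on:
  assumes "Ck_on 2 f S" "x \<in> S" "open S"
  shows "\<exists>d. has_lap f d (laplacian f x) x"
proof -
  define g where "g y = (\<Sum>b\<in>Basis. frechet_derivative f (at y) b *\<^sub>R b)" for y
  define G where "G h = (\<Sum>b\<in>Basis. frechet_derivative (\<lambda>y. frechet_derivative f (at y) b) (at x) h *\<^sub>R b)" for h
  have C: "f differentiable (at y)" "b \<in> Basis \<Longrightarrow> (\<lambda>z. frechet_derivative f (at z) b) differentiable (at y)"
    if "y \<in> S" for y b
    using assms(1) that by (auto simp: numeral_2_eq_2)
  have "has_lap f (g x) (laplacian f x) x"
  proof (rule has_lapI)
    show "\<forall>\<^sub>F y in nhds x. (f has_derivative (\<lambda>h. g y \<bullet> h)) (at y)"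
      using eventually_nhds_in_open[OF assms(3,2)]
    proof eventually_elim
      case (elim y)
      have D: "(f has_derivative frechet_derivative f (at y)) (at y)"
        using C(1)[OF elim] by (simp add: frechet_derivative_works)
      interpret D: linear "frechet_derivative f (at y)" using D by (rule has_derivative_linear)
      have "frechet_derivative f (at y) h = g y \<bullet> h" for h
      proof -
        have "frechet_derivative f (at y) h = frechet_derivative f (at y) (\<Sum>b\<in>Basis. (h \<bullet> b) *\<^sub>R b)"
          by (simp add: euclidean_representation)
        also have "\<dots> = g y \<bullet> h"
          by (simp add: D.sum D.scaleR g_def inner_sum_left inner_sum_right inner_commute mult.commute)
        finally show ?thesis .
      qed
      then show ?case using D by (metis (no_types, lifting) ext)
    qed
    show "(g has_derivative G) (at x)"
      unfolding g_def G_def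
      using C(2)[OF assms(2)] frechet_derivative_works
      by (intro has_derivative_sum has_derivative_scaleR_left) blast
    show "(\<Sum>b\<in>Basis. G b \<bullet> b) = laplacian f x"
      unfolding laplacian_def
    proof (rule sum.cong[OF refl])
      fix b :: 'a assume b: "b \<in> Basis"
      then show "G b \<bullet> b = frechet_derivative (\<lambda>y. frechet_derivative f (at y) b) (at x) b"
        by (simp add: G_def inner_sum_left inner_Basis if_distrib sum.delta cong: if_cong)
    qed
  qed simp
  then show ?thesis by blast
qed

section \<open>Maximum principles\<close>

text \<open>The conditions at the frontier and at infinity make the superlevel set of a positive
  value closed and bounded, so a positive maximum would be attained in \<open>U\<close>; excluding
  it is left to the equation, through \<open>max\<close>. At the frontier \<open>f\<close> is only
  bounded from above, since later it may be discontinuous there.\<close>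

lemma nonpos_if_no_positive_maximum:
  fixes f :: "'a::euclidean_space \<Rightarrow> real"
  assumes U: "open U" and f: "continuous_on U f"
    and bdry: "\<And>y \<epsilon>. y \<in> frontier U \<Longrightarrow> \<epsilon> > 0 \<Longrightarrow> \<forall>\<^sub>F x in at y within U. f x < \<epsilon>"
    and inf: "\<And>\<epsilon>. \<epsilon> > 0 \<Longrightarrow> \<exists>R. \<forall>x\<in>U. norm x \<ge> R \<longrightarrow> f x < \<epsilon>"
    and max: "\<And>x. x \<in> U \<Longrightarrow> f x > 0 \<Longrightarrow> (\<forall>y\<in>U. f y \<le> f x) \<Longrightarrow> False"
    and x: "x \<in> U"
  shows "f x \<le> 0"
proof (rule ccontr)
  assume "\<not> f x \<le> 0"
  then have pos: "f x > 0" by simp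
  define A where "A = {y\<in>U. f y \<ge> f x}"
  obtain R where R: "\<And>y. y \<in> U \<Longrightarrow> norm y \<ge> R \<Longrightarrow> f y < f x" using inf[OF pos] by blast
  have "bounded A"
    unfolding bounded_iff A_def using R by (intro exI[of _ R]) force
  moreover have "closed A"
    unfolding closed_sequential_limits
  proof (intro allI impI, elim conjE)
    fix X y assume X: "\<forall>k. X k \<in> A" "X \<longlonglongrightarrow> y"
    have y: "y \<in> closure U"
      using X unfolding closure_sequential A_def by blast
    have "y \<in> U"
    proof (rule ccontr)
      assume nU: "y \<notin> U"
      then have "y \<in> frontier U" using y U by (simp add: frontier_def interior_open)
      from bdry[OF this pos] have "\<forall>\<^sub>F k in sequentially. f (X k) < f x"
      proof (rule eventually_compose_filterlim)
        show "filterlim X (at y within U) sequentially"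
          using X nU by (auto simp: filterlim_at A_def intro!: always_eventually)
      qed
      then obtain k where "f (X k) < f x" by (auto simp: eventually_sequentially)
      then show False using X(1) by (auto simp: A_def dest: spec[of _ k])
    qed
    then have "isCont f y" using f U by (simp add: continuous_on_eq_continuous_at)
    then have "(\<lambda>k. f (X k)) \<longlonglongrightarrow> f y" using X(2) by (rule isCont_tendsto_compose)
    then have "f x \<le> f y" by (rule LIMSEQ_le_const) (use X in \<open>auto simp: A_def\<close>)
    then show "y \<in> A" using \<open>y \<in> U\<close> by (simp add: A_def)
  qed
  ultimately have "compact A" by (simp add: compact_eq_bounded_closed)
  moreover have "A \<noteq> {}" using x by (auto simp: A_def)
  moreover have "continuous_on A f" using f by (rule continuous_on_subset) (auto simp: A_def)
  ultimately have "\<exists>z\<in>A. \<forall>y\<in>A. f y \<le> f z" by (rule continuous_attains_sup)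
  then obtain z where z: "z \<in> A" "\<And>y. y \<in> A \<Longrightarrow> f y \<le> f z" by blast
  have "f y \<le> f z" if "y \<in> U" for y
  proof (cases "f y \<ge> f x")
    case True
    then show ?thesis using z(2)[of y] that by (simp add: A_def)
  next
    case False
    then show ?thesis using z(1) by (simp add: A_def)
  qed
  moreover have "z \<in> U" "f z > 0" using z(1) pos by (auto simp: A_def)
  ultimately show False using max by blast
qed

text \<open>Quantitative core of both the strong maximum principle and Hopf's lemma. With exponent
  \<open>- n\<close> instead of the harmonic \<open>2 - n\<close>, the Laplacian of the barrier is
  strictly positive, so its difference with a superharmonic \<open>W\<close> has no interior
  maximum.\<close>

lemma annulus_barrier:
  fixes W :: "'a::euclidean_space \<Rightarrow> real" and c :: 'a
  assumes r: "0 < r" "r < R"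
    and sup: "\<And>x. x \<in> ball c R \<Longrightarrow> W x \<ge> 0 \<and> (\<exists>d L. has_lap W d L x \<and> L \<le> 0)"
    and inner: "\<And>x. x \<in> cball c r \<Longrightarrow> W x > 0"
  shows "\<exists>\<epsilon>>0. \<forall>x\<in>ball c R - cball c r. \<epsilon> * (norm (x - c) powr - real DIM('a) - R powr - real DIM('a)) \<le> W x"
proof -
  let ?n = "real DIM('a)"
  have n: "?n > 0" by simp
  have cont: "isCont W x" if "x \<in> ball c R" for x
    using sup[OF that] has_lap_isCont by blast
  have "continuous_on (cball c r) W"
    using cont r by (intro continuous_at_imp_continuous_on ballI) auto
  then obtain x0 where x0: "x0 \<in> cball c r" "\<And>x. x \<in> cball c r \<Longrightarrow> W x0 \<le> W x"
    using continuous_attains_inf[OF compact_cball, of c r W] r by force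
  \<comment> \<open>Scales the barrier to the minimum of \<open>W\<close> on the inner ball; the
    subtracted constant only lowers the barrier further, and makes it vanish on the outer
    sphere.\<close>
  define \<epsilon> where "\<epsilon> = W x0 / r powr (- ?n)"
  have \<epsilon>: "\<epsilon> > 0" using inner[OF x0(1)] r by (simp add: \<epsilon>_def)
  define b where "b x = \<epsilon> * (norm (x - c) powr - ?n - R powr - ?n)" for x
  define U where "U = ball c R - cball c r"
  have bcont: "isCont b x" if "x \<noteq> c" for x
    unfolding b_def using that by (intro continuous_intros) auto
  have "b x - W x \<le> 0" if "x \<in> U" for x
  proof (rule nonpos_if_no_positive_maximum[where U=U and f="\<lambda>x. b x - W x"])
    show "open U" unfolding U_def by (simp add: open_Diff)
    show "continuous_on U (\<lambda>x. b x - W x)"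
    proof (intro continuous_at_imp_continuous_on ballI)
      fix x assume "x \<in> U"
      then have "x \<noteq> c" "x \<in> ball c R" using r by (auto simp: U_def)
      then show "isCont (\<lambda>x. b x - W x) x" using bcont cont by (intro continuous_intros)
    qed
    show "\<exists>R. \<forall>x\<in>U. norm x \<ge> R \<longrightarrow> b x - W x < \<delta>" for \<delta>
    proof (intro exI[of _ "norm c + R"] ballI impI)
      fix x assume "x \<in> U" "norm c + R \<le> norm x"
      then show "b x - W x < \<delta>"
        using norm_triangle_ineq2[of x c] by (simp add: U_def dist_norm norm_minus_commute)
    qed
    show "\<forall>\<^sub>F x in at y within U. b x - W x < \<delta>" if y: "y \<in> frontier U" and \<delta>: "\<delta> > 0" for y \<delta>
    proof -
      have "y \<in> closure U" "y \<notin> U"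
        using y \<open>open U\<close> by (auto simp: frontier_def interior_open)
      moreover have "closure U \<subseteq> cball c R - ball c r"
        by (rule closure_minimal) (auto simp: U_def)
      ultimately have "dist c y = r \<or> dist c y = R" by (auto simp: U_def)
      then show ?thesis
      proof
        assume dr: "dist c y = r"
        then have yc: "y \<noteq> c" "y \<in> ball c R" "y \<in> cball c r" using r by auto
        have "b y < \<epsilon> * r powr - ?n"
          using dr \<epsilon> r by (simp add: b_def dist_norm norm_minus_commute)
        also have "\<dots> = W x0" using r by (simp add: \<epsilon>_def)
        also have "\<dots> \<le> W y" using x0 yc by blast
        finally have "b y - W y < \<delta>" using \<delta> by simp
        moreover have "((\<lambda>x. b x - W x) \<longlongrightarrow> b y - W y) (at y within U)"
          using bcont[OF yc(1)] cont[OF yc(2)] by (intro tendsto_diff) (auto simp: isCont_def intro: tendsto_within_subset)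
        ultimately show ?thesis by (rule order_tendstoD(2)[rotated])
      next
        assume dR: "dist c y = R"
        then have yc: "y \<noteq> c" using r by auto
        have "b y < \<delta>" using dR \<delta> by (simp add: b_def dist_norm norm_minus_commute)
        moreover have "(b \<longlongrightarrow> b y) (at y within U)"
          using bcont[OF yc] by (auto simp: isCont_def intro: tendsto_within_subset)
        ultimately have "\<forall>\<^sub>F x in at y within U. b x < \<delta>" by (rule order_tendstoD(2)[rotated])
        moreover have "\<forall>\<^sub>F x in at y within U. x \<in> U" by (simp add: eventually_at_topological) (use open_UNIV in blast)
        ultimately show ?thesis
        proof eventually_elim
          case (elim x)
          then show ?case using sup[of x] by (auto simp: U_def)
        qed
      qed
    qed
    show False if x: "x \<in> U" and "\<forall>y\<in>U. b y - W y \<le> b x - W x" for x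
    proof -
      have xc: "x \<noteq> c" "x \<in> ball c R" using x r by (auto simp: U_def)
      obtain d L where L: "has_lap W d L x" "L \<le> 0" using sup[OF xc(2)] by blast
      have "has_lap b (\<epsilon> *\<^sub>R ((- ?n * norm (x - c) powr (- ?n - 2)) *\<^sub>R (x - c) - 0))
         (\<epsilon> * (- ?n * (- ?n + ?n - 2) * norm (x - c) powr (- ?n - 2) - 0)) x"
        unfolding b_def by (intro has_lap_cmult has_lap_diff has_lap_norm_powr has_lap_const xc)
      from has_lap_diff[OF this L(1)]
      have "\<epsilon> * (- ?n * (- ?n + ?n - 2) * norm (x - c) powr (- ?n - 2) - 0) - L \<le> 0"
        by (rule has_lap_local_max)
           (use eventually_nhds_in_open[OF \<open>open U\<close> x] that in \<open>auto elim!: eventually_mono\<close>)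
      moreover have "\<epsilon> * (- ?n * (- ?n + ?n - 2) * norm (x - c) powr (- ?n - 2) - 0) > 0"
        using \<epsilon> n xc by simp
      ultimately show False using L(2) by linarith
    qed
    show "x \<in> U" by fact
  qed
  then show ?thesis using \<epsilon> unfolding b_def U_def by (intro exI[of _ \<epsilon>]) fastforce
qed

lemma powr_minus_DIM_less:
  assumes "0 < s" "s < R"
  shows "R powr - real DIM('a::euclidean_space) < s powr - real DIM('a)"
  using assms by (intro powr_less_mono2_neg) auto

text \<open>The positivity set is open by continuity. It is also closed in \<open>U\<close>: a limit
  point lies in a ball around a nearby positive point \<open>c\<close>, and there either close to
  \<open>c\<close> or in an annulus on which the barrier is positive.\<close>

lemma strong_maximum_principle:
  fixes W :: "'a::euclidean_space \<Rightarrow> real"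
  assumes U: "open U" "connected U"
    and sup: "\<And>x. x \<in> U \<Longrightarrow> W x \<ge> 0 \<and> (\<exists>d L. has_lap W d L x \<and> L \<le> 0)"
    and pos: "x0 \<in> U" "W x0 > 0" and x: "x \<in> U"
  shows "W x > 0"
proof -
  have cont: "isCont W x" if "x \<in> U" for x
    using sup[OF that] has_lap_isCont by blast
  have Wc: "continuous_on U W" using cont by (simp add: continuous_at_imp_continuous_on)
  define P where "P = {x\<in>U. W x > 0}"
  have "openin (top_of_set U) P"
    unfolding P_def by (rule continuous_openin_preimage_gen[OF Wc open_greaterThan, of 0, unfolded vimage_def, simplified Int_def greaterThan_iff mem_Collect_eq])
  moreover have "closedin (top_of_set U) P"
    unfolding closedin_limpt
  proof (intro conjI allI impI)
    show "P \<subseteq> U" by (auto simp: P_def)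
    fix y assume y: "y islimpt P \<and> y \<in> U"
    \<comment> \<open>Radius \<open>2 * r\<close> leaves room: the ball of radius \<open>r\<close>
      about any point closer than \<open>r\<close> to \<open>y\<close> stays in
      \<open>U\<close>.\<close>
    obtain r where r: "r > 0" "ball y (2 * r) \<subseteq> U"
      using U(1) y unfolding open_contains_ball by (metis field_sum_of_halves half_gt_zero mult_2)
    obtain c where c: "c \<in> P" "c \<noteq> y" "dist c y < r" using y r(1) unfolding islimpt_approachable by blast
    have cr: "ball c r \<subseteq> U"
    proof
      fix z assume "z \<in> ball c r"
      then have "dist y z < 2 * r" using c(3) dist_triangle[of y z c] by (simp add: dist_commute)
      then show "z \<in> U" using r(2) by auto
    qed
    have "isCont W c" "W c > 0" using c cont by (auto simp: P_def)
    then have "\<forall>\<^sub>F z in nhds c. W z > 0"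
      by (auto simp: isCont_def tendsto_nhds_iff intro!: order_tendstoD(1)[of W "W c"])
    then obtain e where e: "e > 0" "\<And>z. dist z c < e \<Longrightarrow> W z > 0"
      unfolding eventually_nhds_metric by blast
    define s where "s = min e r / 2"
    have s: "0 < s" "s < r" "s < e" using e r by (auto simp: s_def)
    have inn: "W z > 0" if "z \<in> cball c s" for z
      using that s e(2)[of z] by (auto simp: dist_commute)
    obtain \<epsilon> where \<epsilon>: "\<epsilon> > 0" "\<forall>z\<in>ball c r - cball c s.
        \<epsilon> * (norm (z - c) powr - real DIM('a) - r powr - real DIM('a)) \<le> W z"
      using annulus_barrier[OF s(1,2), of c W] sup cr inn by blast
    have "W y > 0"
    proof (cases "y \<in> cball c s")
      case False
      have "0 < \<epsilon> * (norm (y - c) powr - real DIM('a) - r powr - real DIM('a))"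
        using c \<epsilon>(1) powr_minus_DIM_less[where 'a='a, of "norm (y - c)" r] by (simp add: dist_norm norm_minus_commute)
      also have "\<dots> \<le> W y" using \<epsilon>(2) False c(3) by auto
      finally show ?thesis .
    qed (rule inn)
    then show "y \<in> P" using y by (auto simp: P_def)
  qed
  ultimately have "P = {} \<or> P = U" using U(2) connected_clopen by blast
  then show ?thesis using pos x by (auto simp: P_def)
qed

text \<open>The ball touches \<open>y\<close> from the direction \<open>e\<close>. At
  \<open>y + s *\<^sub>R e\<close> the distance to its centre is \<open>\<rho> - s\<close>, so along
  the half line the barrier is the explicit function \<open>b\<close>, which starts at 0 with
  positive slope and stays below \<open>W\<close>.\<close>

lemma hopf_half_line:
  fixes W :: "'a::euclidean_space \<Rightarrow> real" and y e :: 'a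
  assumes \<rho>: "\<rho> > 0" and e: "norm e = 1"
    and sup: "\<And>x. x \<in> ball (y + \<rho> *\<^sub>R e) \<rho> \<Longrightarrow> W x > 0 \<and> (\<exists>d L. has_lap W d L x \<and> L \<le> 0)"
    and W0: "W y = 0" and D: "((\<lambda>s. W (y + s *\<^sub>R e)) has_real_derivative D) (at 0)"
  shows "D > 0"
proof -
  let ?n = "real DIM('a)" and ?c = "y + \<rho> *\<^sub>R e"
  obtain \<epsilon> where \<epsilon>: "\<epsilon> > 0" "\<forall>z\<in>ball ?c \<rho> - cball ?c (\<rho>/2).
      \<epsilon> * (norm (z - ?c) powr - ?n - \<rho> powr - ?n) \<le> W z"
    using annulus_barrier[of "\<rho>/2" \<rho> ?c W] \<rho> sup by (force simp: less_imp_le)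
  define b where "b s = \<epsilon> * ((\<rho> - s) powr - ?n - \<rho> powr - ?n)" for s
  have b: "(b has_real_derivative \<epsilon> * (?n * \<rho> powr (- ?n - 1))) (at 0)"
    unfolding b_def using \<rho>
    by (auto intro!: derivative_eq_intros simp: powr_diff field_simps)
  have le: "b s \<le> W (y + s *\<^sub>R e)" if s: "0 < s" "s < \<rho>/2" for s
  proof -
    have "y + s *\<^sub>R e - ?c = (s - \<rho>) *\<^sub>R e" by (simp add: algebra_simps)
    then have "norm (y + s *\<^sub>R e - ?c) = \<rho> - s" using e s by simp
    then show ?thesis using \<epsilon>(2) s unfolding b_def
      by (auto simp: dist_norm norm_minus_commute dest!: bspec[of _ _ "y + s *\<^sub>R e"])
  qed
  have "0 \<le> D - \<epsilon> * (?n * \<rho> powr (- ?n - 1))"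
  proof (rule ccontr)
    assume "\<not> ?thesis"
    then have neg: "D - \<epsilon> * (?n * \<rho> powr (- ?n - 1)) < 0" by simp
    obtain h where h: "h > 0" "\<And>s. 0 < s \<Longrightarrow> s < h \<Longrightarrow>
        W (y + (0 + s) *\<^sub>R e) - b (0 + s) < W (y + 0 *\<^sub>R e) - b 0"
      using DERIV_neg_dec_right[OF DERIV_diff[OF D b] neg] by blast
    define s where "s = min (h/2) (\<rho>/4)"
    have s: "0 < s" "s < h" "s < \<rho>/2" using h \<rho> by (auto simp: s_def)
    have "b 0 = 0" by (simp add: b_def)
    then show False using h(2)[OF s(1,2)] le[OF s(1,3)] W0 by simp
  qed
  moreover have "\<epsilon> * (?n * \<rho> powr (- ?n - 1)) > 0" using \<epsilon> \<rho> by simp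
  ultimately show ?thesis by linarith
qed

section \<open>Moving planes\<close>

text \<open>Mean value theorem, with the slope taken at the larger value \<open>A\<close>. In the
  application \<open>A\<close> is the unreflected \<open>v\<close>, which is bounded and decays
  beyond the plane, whereas its reflection may be close to a singularity.\<close>

lemma powr_diff_le:
  fixes A B p :: real
  assumes "0 \<le> B" "B < A" "p > 1"
  shows "A powr p - B powr p \<le> p * A powr (p - 1) * (A - B)"
proof -
  have der: "((\<lambda>s. s powr p) has_real_derivative p * z powr (p - 1)) (at z)" if "z > 0" for z
    using that by (rule has_real_derivative_powr)
  have c: "continuous_on {B..A} (\<lambda>s. s powr p)"
    using assms by (intro continuous_on_powr' continuous_intros) auto
  have d: "(\<lambda>s. s powr p) differentiable (at z)" if "B < z" "z < A" for z
  proof -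
    have "z > 0" using that assms(1) by linarith
    then show ?thesis unfolding real_differentiable_def using der by blast
  qed
  from MVT[OF assms(2) c d] obtain l z where z: "B < z" "z < A"
      "((\<lambda>s. s powr p) has_real_derivative l) (at z)" "A powr p - B powr p = (A - B) * l"
    by auto
  have "z > 0" using z(1) assms(1) by linarith
  then have "l = p * z powr (p - 1)"
    by (rule DERIV_unique[OF z(3) der])
  also have "\<dots> \<le> p * A powr (p - 1)"
    using z assms by (intro mult_left_mono powr_mono2) auto
  finally have "(A - B) * l \<le> (A - B) * (p * A powr (p - 1))"
    using assms by (intro mult_left_mono) auto
  then show ?thesis unfolding z(4) by (simp only: mult.commute[of "A - B"])
qed

lemma inner_mirror: "mirror e t x \<bullet> \<nu> = x \<bullet> \<nu> + 2 * (t - x \<bullet> e) * (e \<bullet> \<nu>)"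
  by (simp add: mirror_def inner_add_left)

lemma continuous_mirror: "isCont (mirror e t) x"
  unfolding mirror_def by (intro continuous_intros)

text \<open>What the moving planes use of the Kelvin transform. The singular set \<open>S\<close>
  stays behind every plane with \<open>t > 0\<close>, but its mirror images may lie on the boundary
  of the region beyond the plane. \<open>asym\<close> is the form in which the non-removable
  singularity enters.\<close>

locale half_space_solution =
  fixes v :: "'a::euclidean_space \<Rightarrow> real" and \<nu> e :: 'a and S :: "'a set" and N C R0 p n :: real
  assumes n_def: "n = real DIM('a)" and n_ge: "n \<ge> 3"
    and \<nu>: "norm \<nu> = 1" and e: "norm e = 1" and orth: "e \<bullet> \<nu> = 0"
    and S: "\<And>s. s \<in> S \<Longrightarrow> s \<bullet> \<nu> = 0 \<and> s \<bullet> e \<le> 0"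
    and cont: "continuous_on ({x. x \<bullet> \<nu> \<ge> 0} - S) v"
    and nonneg: "\<And>x. x \<bullet> \<nu> \<ge> 0 \<Longrightarrow> x \<notin> S \<Longrightarrow> v x \<ge> 0"
    and bdry: "\<And>x. x \<bullet> \<nu> = 0 \<Longrightarrow> x \<notin> S \<Longrightarrow> v x = 0"
    and N: "N > 0" and p: "p = (n + 2) / (n - 2)"
    and pde: "\<And>x. x \<bullet> \<nu> > 0 \<Longrightarrow> \<exists>d. has_lap v d (- N * v x powr p) x"
    and C: "C > 0" and R0: "R0 > 0"
    and decay: "\<And>x. x \<bullet> \<nu> \<ge> 0 \<Longrightarrow> x \<notin> S \<Longrightarrow> norm x \<ge> R0 \<Longrightarrow> v x \<le> C * norm x powr (2 - n)"
    and asym: "\<And>t. t > 0 \<Longrightarrow> \<exists>x. x \<bullet> \<nu> > 0 \<and> x \<bullet> e > t \<and> v x \<noteq> v (mirror e t x)"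
begin

lemma ee: "e \<bullet> e = 1" "\<nu> \<bullet> \<nu> = 1" "\<nu> \<bullet> e = 0"
  using e \<nu> orth by (auto simp: dot_square_norm inner_commute)

text \<open>The second identity turns the decay exponent \<open>2 - n\<close> of \<open>v\<close>
  into the exponent \<open>- 4\<close> for \<open>v powr (p - 1)\<close>.\<close>

lemma p_gt: "p > 1" "(2 - n) * (p - 1) = -4"
  using n_ge unfolding p by (auto simp: field_simps)

lemma mirror_simps: "mirror e t x \<bullet> \<nu> = x \<bullet> \<nu>" "mirror e t x \<bullet> e = 2 * t - x \<bullet> e"
  using ee orth by (auto simp: inner_mirror)

lemma isCont_v: "x \<bullet> \<nu> > 0 \<Longrightarrow> isCont v x"
  using pde has_lap_isCont by blast

lemma nonneg': "x \<bullet> \<nu> > 0 \<Longrightarrow> v x \<ge> 0"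
  using nonneg[of x] S[of x] by fastforce

lemma isCont_v_mirror: "x \<bullet> \<nu> > 0 \<Longrightarrow> isCont (\<lambda>x. v (mirror e t x)) x"
  using isCont_o2[OF continuous_mirror isCont_v] by (simp add: mirror_simps)

lemma pde_diff:
  assumes "x \<bullet> \<nu> > 0"
  shows "\<exists>d. has_lap (\<lambda>y. v (mirror e t y) - v y) d (N * (v x powr p - v (mirror e t x) powr p)) x"
proof -
  obtain d1 where d1: "has_lap v d1 (- N * v x powr p) x" using pde[OF assms] by blast
  obtain d2 where d2: "has_lap v d2 (- N * v (mirror e t x) powr p) (mirror e t x)"
    using pde[of "mirror e t x"] assms by (auto simp: mirror_simps)
  from has_lap_diff[OF has_lap_mirror[OF e d2] d1] show ?thesis
    by (auto simp: algebra_simps)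
qed

section \<open>Supersolution and comparison beyond a plane\<close>

definition \<Sigma> :: "real \<Rightarrow> 'a set" where "\<Sigma> t = {x. x \<bullet> \<nu> > 0 \<and> x \<bullet> e > t}"

lemma open_\<Sigma>: "open (\<Sigma> t)"
  unfolding \<Sigma>_def by (intro open_Collect_conj open_Collect_less continuous_intros)

lemma norm_ge: "x \<bullet> e \<le> norm x"
  using Cauchy_Schwarz_ineq2[of x e] e by simp

text \<open>Non-strict, hence stable under limits in \<open>t\<close>; strictness is recovered by
  the strong maximum principle.\<close>

definition good :: "real \<Rightarrow> bool" where
  "good t \<longleftrightarrow> (\<forall>x\<in>\<Sigma> t. v x \<le> v (mirror e t x))"

text \<open>The Hardy exponent: \<open>norm x powr (- \<alpha>)\<close> has Laplacian
  \<open>- \<alpha>\<^sup>2 / (norm x)\<^sup>2\<close> times itself, and no other power of the norm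
  gives a larger constant.\<close>

definition \<alpha> :: real where "\<alpha> = (n - 2) / 2"

lemma \<alpha>: "\<alpha> > 0" "n - 2 = 2 * \<alpha>"
  using n_ge by (auto simp: \<alpha>_def)

text \<open>The Hardy weight \<open>|x| powr (- (n - 2) / 2)\<close> times a factor that is concave in the distances to
  both boundary planes; since the weight decreases in these directions, the cross terms of the
  Laplacian are negative.\<close>

definition decayfn :: "real \<Rightarrow> real \<Rightarrow> 'a \<Rightarrow> real" where
  "decayfn l t x = norm x powr (- \<alpha>) * (4 - exp (- l * (\<nu> \<bullet> x - 0)) - exp (- l * (e \<bullet> x - t)))"

lemma decayfn_bounds:
  assumes "l > 0" "x \<bullet> \<nu> \<ge> 0" "x \<bullet> e \<ge> t" "t > 0"
  shows "2 * norm x powr (- \<alpha>) \<le> decayfn l t x" "decayfn l t x \<le> 4 * norm x powr (- \<alpha>)" "decayfn l t x > 0"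
proof -
  have "exp (- l * (\<nu> \<bullet> x - 0)) \<le> 1" "exp (- l * (e \<bullet> x - t)) \<le> 1"
    using assms by (auto simp: inner_commute)
  then have b: "2 \<le> 4 - exp (- l * (\<nu> \<bullet> x - 0)) - exp (- l * (e \<bullet> x - t))" by linarith
  then show 2: "2 * norm x powr (- \<alpha>) \<le> decayfn l t x"
    unfolding decayfn_def using mult_left_mono[OF b, of "norm x powr - \<alpha>"] by (simp add: mult.commute)
  have b4: "4 - exp (- l * (\<nu> \<bullet> x - 0)) - exp (- l * (e \<bullet> x - t)) \<le> 4"
    by (smt (verit) exp_gt_zero)
  then show "decayfn l t x \<le> 4 * norm x powr (- \<alpha>)"
    unfolding decayfn_def using mult_left_mono[OF b4, of "norm x powr - \<alpha>"] by (simp add: mult.commute)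
  have "x \<noteq> 0" using assms by auto
  then have "norm x powr (- \<alpha>) > 0" by simp
  then show "decayfn l t x > 0" using 2 by linarith
qed

lemma decayfn_supersolution:
  assumes l: "l > 0" and x: "x \<bullet> \<nu> > 0" "x \<bullet> e > t" and t: "t > 0"
  shows "\<exists>d L. has_lap (decayfn l t) d L x \<and>
    L \<le> - (\<alpha>\<^sup>2 / (norm x)\<^sup>2 + l\<^sup>2 / 4 * (exp (- l * (x \<bullet> \<nu>)) + exp (- l * (x \<bullet> e - t)))) * decayfn l t x"
proof -
  define e1 where "e1 = exp (- l * (\<nu> \<bullet> x - 0))"
  define e2 where "e2 = exp (- l * (e \<bullet> x - t))"
  define \<psi> where "\<psi> = norm x powr (- \<alpha>)"
  define Q where "Q = norm x powr (- \<alpha> - 2)"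
  have x0: "x \<noteq> 0" using x t by auto
  have pos: "e1 > 0" "e2 > 0" "\<psi> > 0" "Q > 0" using x0 by (auto simp: e1_def e2_def \<psi>_def Q_def)
  have Q: "Q = \<psi> / (norm x)\<^sup>2"
    using x0 by (simp add: Q_def \<psi>_def powr_diff)
  have dec: "decayfn l t x = \<psi> * (4 - e1 - e2)"
    by (simp add: decayfn_def \<psi>_def e1_def e2_def)
  have dec4: "decayfn l t x \<le> 4 * \<psi>"
    using decayfn_bounds(2)[of l x t] assms by (simp add: \<psi>_def)
  have 1: "has_lap (\<lambda>x. norm x powr (- \<alpha>)) ((- \<alpha> * Q) *\<^sub>R x) (- \<alpha> * (- \<alpha> + n - 2) * Q) x"
    using has_lap_norm_powr[OF x0, of "- \<alpha>"] by (simp add: Q_def n_def)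
  have 2: "has_lap (\<lambda>x. 4 - exp (- l * (\<nu> \<bullet> x - 0)) - exp (- l * (e \<bullet> x - t)))
     (0 - (- (l * e1) *\<^sub>R \<nu>) - (- (l * e2) *\<^sub>R e)) (0 - l\<^sup>2 * e1 - l\<^sup>2 * e2) x"
    unfolding e1_def e2_def by (intro has_lap_diff has_lap_const has_lap_exp_linear \<nu> e)
  define L where "L = \<psi> * (0 - l\<^sup>2 * e1 - l\<^sup>2 * e2) + (4 - e1 - e2) * (- \<alpha> * (- \<alpha> + n - 2) * Q)
    + 2 * (((- \<alpha> * Q) *\<^sub>R x) \<bullet> (0 - (- (l * e1) *\<^sub>R \<nu>) - (- (l * e2) *\<^sub>R e)))"
  have "\<exists>d. has_lap (decayfn l t) d L x"
    using has_lap_mult[OF 1 2] unfolding decayfn_def[abs_def] L_def \<psi>_def e1_def e2_def by blast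
  moreover have "L = - (\<alpha>\<^sup>2 / (norm x)\<^sup>2) * decayfn l t x - \<psi> * l\<^sup>2 * (e1 + e2)
     - 2 * \<alpha> * Q * l * (e1 * (x \<bullet> \<nu>) + e2 * (x \<bullet> e))"
  proof -
    have a: "- \<alpha> + n - 2 = \<alpha>" using \<alpha> by simp
    show ?thesis unfolding L_def dec Q a
      by (simp add: inner_add_right algebra_simps power2_eq_square add_divide_distrib diff_divide_distrib)
  qed
  moreover have "2 * \<alpha> * Q * l * (e1 * (x \<bullet> \<nu>) + e2 * (x \<bullet> e)) \<ge> 0"
    using pos \<alpha> l x t by (intro mult_nonneg_nonneg add_nonneg_nonneg) auto
  \<comment> \<open>The exponentials contribute a multiple of \<open>\<psi>\<close>, which has to
    become a multiple of \<open>decayfn\<close> itself; the bound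
    \<open>decayfn l t x \<le> 4 * \<psi>\<close> is the origin of the factor
    \<open>1 / 4\<close>.\<close>
  moreover have "\<psi> * l\<^sup>2 * (e1 + e2) \<ge> l\<^sup>2 / 4 * (e1 + e2) * decayfn l t x"
  proof -
    have "l\<^sup>2 / 4 * (e1 + e2) * decayfn l t x \<le> l\<^sup>2 / 4 * (e1 + e2) * (4 * \<psi>)"
      by (rule mult_left_mono[OF dec4]) (use pos in simp)
    then show ?thesis by (simp add: algebra_simps)
  qed
  moreover have "a = b - c - d \<Longrightarrow> 0 \<le> d \<Longrightarrow> r \<le> c \<Longrightarrow> a \<le> b - r" for a b c d r :: real
    by linarith
  ultimately have "(\<exists>d. has_lap (decayfn l t) d L x) \<and>
    L \<le> - (\<alpha>\<^sup>2 / (norm x)\<^sup>2) * decayfn l t x - l\<^sup>2 / 4 * (e1 + e2) * decayfn l t x"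
    by blast
  then show ?thesis
    unfolding e1_def e2_def by (auto simp: inner_commute algebra_simps)
qed

text \<open>Maximum principle for the quotient of \<open>v - v \<circ> mirror\<close> by a positive
  supersolution. The linearised potential has the wrong sign for a direct comparison, but is
  absorbed while it stays below the potential gained by \<open>decayfn\<close>. Positive values of
  the quotient occur only where \<open>v\<close> exceeds its reflection, so smallness is asked only
  there.\<close>

lemma comparison:
  assumes t: "t > 0" and l: "l > 0"
    and small: "\<And>x. x \<in> \<Sigma> t \<Longrightarrow> v x > v (mirror e t x) \<Longrightarrow>
      N * p * v x powr (p - 1) < \<alpha>\<^sup>2 / (norm x)\<^sup>2 + l\<^sup>2 / 4 * (exp (- l * (x \<bullet> \<nu>)) + exp (- l * (x \<bullet> e - t)))"
  shows "good t"
proof -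
  define \<phi> where "\<phi> = decayfn l t"
  define f where "f x = (v x - v (mirror e t x)) / \<phi> x" for x
  have \<phi>pos: "\<phi> x > 0" if "x \<bullet> \<nu> \<ge> 0" "x \<bullet> e \<ge> t" for x
    unfolding \<phi>_def using decayfn_bounds(3)[OF l that t] .
  have \<phi>cont: "isCont \<phi> x" if "x \<noteq> 0" for x
    unfolding \<phi>_def decayfn_def[abs_def] using that by (intro continuous_intros) auto
  have fcont: "isCont f x" if "x \<bullet> \<nu> > 0" "x \<bullet> e \<ge> t" for x
    unfolding f_def
    using \<phi>pos[of x] that t by (intro continuous_intros isCont_v isCont_v_mirror \<phi>cont) auto
  \<comment> \<open>Dividing by the weight costs \<open>norm x powr \<alpha>\<close>; as
    \<open>v\<close> decays with exponent \<open>2 - n = - 2 * \<alpha>\<close>, the bound still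
    tends to 0 at infinity.\<close>
  have fle: "f x \<le> v x * norm x powr \<alpha> / 2" if "x \<in> \<Sigma> t" for x
  proof -
    have x: "x \<bullet> \<nu> > 0" "x \<bullet> e \<ge> t" "x \<noteq> 0" using that t by (auto simp: \<Sigma>_def)
    have "f x \<le> v x / \<phi> x"
      unfolding f_def using nonneg'[of "mirror e t x"] \<phi>pos[of x] x
      by (intro divide_right_mono) (auto simp: mirror_simps)
    also have "\<dots> \<le> v x / (2 * norm x powr (- \<alpha>))"
      using nonneg'[of x] x decayfn_bounds(1)[OF l _ x(2) t] unfolding \<phi>_def
      by (intro divide_left_mono mult_pos_pos) (auto intro: decayfn_bounds(3)[OF l _ x(2) t])
    also have "\<dots> = v x * norm x powr \<alpha> / 2" by (simp add: powr_minus field_simps)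
    finally show ?thesis .
  qed
  have "f x \<le> 0" if "x \<in> \<Sigma> t" for x
  proof (rule nonpos_if_no_positive_maximum[OF open_\<Sigma>[of t], of f])
    show "continuous_on (\<Sigma> t) f"
      using fcont by (intro continuous_at_imp_continuous_on ballI) (auto simp: \<Sigma>_def)
    show "\<exists>R. \<forall>x\<in>\<Sigma> t. norm x \<ge> R \<longrightarrow> f x < \<epsilon>" if "\<epsilon> > 0" for \<epsilon>
    proof -
      have "((\<lambda>r. C / 2 * r powr (- \<alpha>)) \<longlongrightarrow> C / 2 * 0) at_top"
        using \<alpha> by (intro tendsto_mult tendsto_const tendsto_neg_powr filterlim_ident) auto
      then have "\<forall>\<^sub>F r in at_top. C / 2 * r powr (- \<alpha>) < \<epsilon>"
        using that by (intro order_tendstoD(2)[of _ "C / 2 * 0"]) auto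
      then obtain R where R: "\<And>r. r \<ge> R \<Longrightarrow> C / 2 * r powr (- \<alpha>) < \<epsilon>"
        unfolding eventually_at_top_linorder by blast
      show ?thesis
      proof (intro exI[of _ "max R R0"] ballI impI)
        fix x assume x: "x \<in> \<Sigma> t" "norm x \<ge> max R R0"
        have xS: "x \<notin> S" "x \<bullet> \<nu> \<ge> 0" "x \<noteq> 0" using x S[of x] t by (auto simp: \<Sigma>_def)
        have "f x \<le> v x * norm x powr \<alpha> / 2" by (rule fle[OF x(1)])
        also have "\<dots> \<le> (C * norm x powr (2 - n)) * norm x powr \<alpha> / 2"
          using decay[OF xS(2,1)] x by (intro divide_right_mono mult_right_mono) auto
        also have "\<dots> = C / 2 * norm x powr (- \<alpha>)"
        proof -
          have "2 - n + \<alpha> = - \<alpha>" using \<alpha> by linarith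
          then have "norm x powr (2 - n) * norm x powr \<alpha> = norm x powr (- \<alpha>)"
            by (metis powr_add)
          then show ?thesis by (simp add: mult.assoc)
        qed
        also have "\<dots> < \<epsilon>" using x R by auto
        finally show "f x < \<epsilon>" .
      qed
    qed
    show "\<forall>\<^sub>F x in at y within \<Sigma> t. f x < \<epsilon>" if y: "y \<in> frontier (\<Sigma> t)" and \<epsilon>: "\<epsilon> > 0" for y \<epsilon>
    proof -
      have "y \<in> closure (\<Sigma> t)" "y \<notin> \<Sigma> t"
        using y open_\<Sigma>[of t] by (auto simp: frontier_def interior_open)
      moreover have "closure (\<Sigma> t) \<subseteq> {x. x \<bullet> \<nu> \<ge> 0 \<and> x \<bullet> e \<ge> t}"
        by (rule closure_minimal)
          (auto simp: \<Sigma>_def intro!: closed_Collect_conj closed_Collect_le continuous_intros)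
      ultimately have y1: "y \<bullet> \<nu> \<ge> 0" "y \<bullet> e \<ge> t" "y \<bullet> \<nu> = 0 \<or> y \<bullet> \<nu> > 0 \<and> y \<bullet> e = t"
        by (auto simp: \<Sigma>_def)
      have y2: "y \<noteq> 0" "y \<notin> S" using y1 t S[of y] by auto
      from y1(3) show ?thesis
      proof
        assume y0: "y \<bullet> \<nu> = 0"
        have "(v \<longlongrightarrow> v y) (at y within ({x. x \<bullet> \<nu> \<ge> 0} - S))"
          using cont y1 y2 by (auto simp: continuous_on_def)
        then have "(v \<longlongrightarrow> 0) (at y within \<Sigma> t)"
          unfolding bdry[OF y0 y2(2)] by (rule tendsto_within_subset) (use S in \<open>fastforce simp: \<Sigma>_def\<close>)
        then have "((\<lambda>x. v x * norm x powr \<alpha> / 2) \<longlongrightarrow> 0 * norm y powr \<alpha> / 2) (at y within \<Sigma> t)"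
          using y2 by (intro tendsto_intros) auto
        then have "\<forall>\<^sub>F x in at y within \<Sigma> t. v x * norm x powr \<alpha> / 2 < \<epsilon>"
          using \<epsilon> by (intro order_tendstoD(2)[of _ "0 * norm y powr \<alpha> / 2"]) auto
        moreover have "\<forall>\<^sub>F x in at y within \<Sigma> t. x \<in> \<Sigma> t"
          by (auto simp: eventually_at_filter)
        ultimately show ?thesis
          by eventually_elim (use fle in force)
      next
        assume y0: "y \<bullet> \<nu> > 0 \<and> y \<bullet> e = t"
        then have "mirror e t y = y" by (simp add: mirror_def)
        then have "f y = 0" by (simp add: f_def)
        moreover have "(f \<longlongrightarrow> f y) (at y within \<Sigma> t)"
          using fcont[of y] y0 by (auto simp: isCont_def intro: tendsto_within_subset)
        ultimately show ?thesis using \<epsilon> by (intro order_tendstoD(2)[of _ 0]) auto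
      qed
    qed
    show False if x: "x \<in> \<Sigma> t" "f x > 0" and max: "\<forall>y\<in>\<Sigma> t. f y \<le> f x" for x
    proof -
      have x1: "x \<bullet> \<nu> > 0" "x \<bullet> e > t" using x by (auto simp: \<Sigma>_def)
      have \<phi>x: "\<phi> x > 0" using \<phi>pos x1 by simp
      define w where "w y = v y - v (mirror e t y)" for y
      have w: "w y = f y * \<phi> y" if "y \<in> \<Sigma> t" for y
        using \<phi>pos[of y] that by (auto simp: f_def w_def \<Sigma>_def)
      have wx: "w x > 0" using w[OF x(1)] x(2) \<phi>x by simp
      define c where "c = N * p * v x powr (p - 1)"
      define k where "k = \<alpha>\<^sup>2 / (norm x)\<^sup>2 + l\<^sup>2 / 4 * (exp (- l * (x \<bullet> \<nu>)) + exp (- l * (x \<bullet> e - t)))"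
      have ck: "c < k" unfolding c_def k_def using small[OF x(1)] wx by (simp add: w_def)
      obtain d1 where d1: "has_lap (\<lambda>y. v (mirror e t y) - v y) d1 (N * (v x powr p - v (mirror e t x) powr p)) x"
        using pde_diff[OF x1(1)] by blast
      obtain d2 L where L: "has_lap \<phi> d2 L x" "L \<le> - k * \<phi> x"
        using decayfn_supersolution[OF l x1 t] unfolding \<phi>_def k_def by blast
      \<comment> \<open>With the maximal quotient \<open>f x\<close> frozen,
        \<open>w - f x * \<phi>\<close> is nonpositive near \<open>x\<close> and zero at
        \<open>x\<close>. This gives the second-order condition without differentiating a
        quotient.\<close>
      have "0 - N * (v x powr p - v (mirror e t x) powr p) - f x * L \<le> 0"
      proof (rule has_lap_local_max)
        show "has_lap (\<lambda>y. 0 - (v (mirror e t y) - v y) - f x * \<phi> y) (0 - d1 - f x *\<^sub>R d2)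
            (0 - N * (v x powr p - v (mirror e t x) powr p) - f x * L) x"
          by (intro has_lap_diff has_lap_const has_lap_cmult d1 L)
        show "\<forall>\<^sub>F y in nhds x. 0 - (v (mirror e t y) - v y) - f x * \<phi> y
            \<le> 0 - (v (mirror e t x) - v x) - f x * \<phi> x"
          using eventually_nhds_in_open[OF open_\<Sigma> x(1)]
        proof eventually_elim
          case (elim y)
          have "w y \<le> f x * \<phi> y"
            using w[OF elim] max elim \<phi>pos[of y] by (auto simp: \<Sigma>_def intro!: mult_right_mono)
          then show ?case using w[OF x(1)] by (simp add: w_def)
        qed
      qed
      moreover have "N * (v x powr p - v (mirror e t x) powr p) \<le> c * w x"
        unfolding c_def w_def
        using mult_left_mono[OF powr_diff_le[of "v (mirror e t x)" "v x" p], of N] N p_gt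
          nonneg'[of "mirror e t x"] wx x1 by (simp add: w_def mirror_simps mult.assoc)
      moreover have "f x * L \<le> f x * (- k * \<phi> x)" using L(2) x(2) by (intro mult_left_mono) auto
      moreover have "f x * (- k * \<phi> x) = - k * w x" using w[OF x(1)] by simp
      moreover have "c * w x < k * w x" using ck wx by simp
      ultimately show False by linarith
    qed
    show "x \<in> \<Sigma> t" by fact
  qed
  then show ?thesis
    unfolding good_def f_def
  proof (intro ballI)
    fix x assume x: "x \<in> \<Sigma> t" and "\<And>x. x \<in> \<Sigma> t \<Longrightarrow> (v x - v (mirror e t x)) / \<phi> x \<le> 0"
    then have "(v x - v (mirror e t x)) / \<phi> x \<le> 0" by blast
    moreover have "\<phi> x > 0" using \<phi>pos[of x] x by (simp add: \<Sigma>_def)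
    ultimately show "v x \<le> v (mirror e t x)" by (simp add: divide_le_0_iff)
  qed
qed

section \<open>Starting the planes and moving them up to the origin\<close>

lemma bounded_v:
  assumes "t > 0"
  shows "\<exists>M. \<forall>x. x \<bullet> \<nu> \<ge> 0 \<longrightarrow> x \<bullet> e \<ge> t \<longrightarrow> v x \<le> M"
proof -
  define K where "K = {x. x \<bullet> \<nu> \<ge> 0} \<inter> {x. x \<bullet> e \<ge> t} \<inter> cball 0 R0"
  have "compact K" unfolding K_def
    by (intro closed_Int_compact closed_Int closed_Collect_le continuous_intros compact_cball)
  moreover have "continuous_on K v"
    using cont by (rule continuous_on_subset) (use S assms in \<open>force simp: K_def\<close>)
  ultimately have "bounded (v ` K)" by (intro compact_imp_bounded compact_continuous_image)
  then obtain M where M: "\<And>x. x \<in> K \<Longrightarrow> v x \<le> M"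
    unfolding bounded_real by (metis abs_le_D1 imageI)
  have "v x \<le> max M (C * R0 powr (2 - n))" if x: "x \<bullet> \<nu> \<ge> 0" "x \<bullet> e \<ge> t" for x
  proof (cases "norm x \<le> R0")
    case True
    then show ?thesis using M[of x] x by (simp add: K_def)
  next
    case False
    have "x \<notin> S" using x assms S[of x] by auto
    then have "v x \<le> C * norm x powr (2 - n)" using decay False x by auto
    also have "\<dots> \<le> C * R0 powr (2 - n)"
      using False R0 C n_ge by (intro mult_left_mono powr_mono2') auto
    finally show ?thesis by simp
  qed
  then show ?thesis by blast
qed

text \<open>Exponent \<open>- 4\<close> against exponent \<open>- 2\<close>. The radius does not
  depend on the plane, so the estimate serves both to start the motion and to continue it.\<close>

lemma far_potential:
  "\<exists>R>0. \<forall>x. x \<bullet> \<nu> > 0 \<longrightarrow> norm x \<ge> R \<longrightarrow> N * p * v x powr (p - 1) < \<alpha>\<^sup>2 / (norm x)\<^sup>2"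
proof -
  define A where "A = N * p * C powr (p - 1)"
  have A: "A > 0" using N p_gt C by (simp add: A_def)
  \<comment> \<open>Beyond \<open>sqrt (2 * A) / \<alpha>\<close> one has
    \<open>2 * A \<le> \<alpha>\<^sup>2 * (norm x)\<^sup>2\<close>; the factor 2 makes the final
    comparison strict.\<close>
  define R where "R = max R0 (sqrt (2 * A) / \<alpha>)"
  have "N * p * v x powr (p - 1) < \<alpha>\<^sup>2 / (norm x)\<^sup>2" if x: "x \<bullet> \<nu> > 0" "norm x \<ge> R" for x
  proof -
    have xp: "norm x > 0" "norm x \<ge> R0" using x R0 by (auto simp: R_def)
    have xS: "x \<notin> S" "x \<bullet> \<nu> \<ge> 0" using x S[of x] by auto
    have "v x powr (p - 1) \<le> (C * norm x powr (2 - n)) powr (p - 1)"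
      using decay[OF xS(2,1) xp(2)] nonneg' x p_gt by (intro powr_mono2) auto
    also have "\<dots> = C powr (p - 1) * norm x powr (-4)"
      using C by (simp add: powr_mult powr_powr p_gt)
    finally have "N * p * v x powr (p - 1) \<le> N * p * (C powr (p - 1) * norm x powr (-4))"
      using N p_gt by (intro mult_left_mono) auto
    also have "\<dots> = A / (norm x)\<^sup>2 * (1 / (norm x)\<^sup>2)"
    proof -
      have "norm x powr (-4) = inverse (norm x ^ 4)"
        using xp powr_minus[of "norm x" 4] by simp
      also have "norm x ^ 4 = (norm x)\<^sup>2 * (norm x)\<^sup>2" by simp
      finally have eq: "norm x powr (-4) = inverse ((norm x)\<^sup>2) * inverse ((norm x)\<^sup>2)"
        by (simp only: inverse_mult_distrib)
      show ?thesis unfolding eq A_def divide_inverse by (simp only: mult.assoc mult_1_left)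
    qed
    also have "\<dots> < \<alpha>\<^sup>2 * (1 / (norm x)\<^sup>2)"
    proof (rule mult_strict_right_mono)
      have "sqrt (2 * A) / \<alpha> \<le> norm x" using x by (simp add: R_def)
      then have "sqrt (2 * A) \<le> norm x * \<alpha>" using \<alpha> by (simp add: field_simps)
      then have "(sqrt (2 * A))\<^sup>2 \<le> (norm x * \<alpha>)\<^sup>2" using A by (intro power_mono) auto
      then have "2 * A \<le> (norm x)\<^sup>2 * \<alpha>\<^sup>2" using A by (simp add: power_mult_distrib)
      then have "A < \<alpha>\<^sup>2 * (norm x)\<^sup>2" using A by (simp add: mult.commute[of "\<alpha>\<^sup>2"])
      then show "A / (norm x)\<^sup>2 < \<alpha>\<^sup>2" using xp by (simp add: pos_divide_less_eq)
    qed (use xp in simp)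
    finally show ?thesis by simp
  qed
  moreover have "R > 0" using R0 by (simp add: R_def)
  ultimately show ?thesis by blast
qed

text \<open>For \<open>t \<ge> R\<close> all of \<open>\<Sigma> t\<close> lies in the far region,
  where the Hardy term alone suffices; the rate \<open>1\<close> of the exponentials is
  arbitrary.\<close>

lemma good_large: "\<exists>T>0. \<forall>t\<ge>T. good t"
proof -
  obtain R where R: "R > 0" "\<And>x. x \<bullet> \<nu> > 0 \<Longrightarrow> norm x \<ge> R \<Longrightarrow>
      N * p * v x powr (p - 1) < \<alpha>\<^sup>2 / (norm x)\<^sup>2"
    using far_potential by blast
  have "good t" if "t \<ge> R" for t
  proof (rule comparison[of t 1])
    fix x assume "x \<in> \<Sigma> t"
    then have x: "x \<bullet> \<nu> > 0" "norm x \<ge> R" using norm_ge[of x] that by (auto simp: \<Sigma>_def)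
    show "N * p * v x powr (p - 1) <
      \<alpha>\<^sup>2 / (norm x)\<^sup>2 + 1\<^sup>2 / 4 * (exp (- 1 * (x \<bullet> \<nu>)) + exp (- 1 * (x \<bullet> e - t)))"
      using R(2)[OF x] by (intro less_le_trans[OF R(2)[OF x]]) auto
  qed (use that R in auto)
  then show ?thesis using R(1) by blast
qed

text \<open>A point beyond the plane \<open>t\<close> is also beyond all planes slightly to its
  right. The case \<open>t = 0\<close> is included and yields the final reflection.\<close>

lemma good_limit:
  assumes good: "\<And>s. s > t \<Longrightarrow> good s"
  shows "good t"
  unfolding good_def
proof
  fix x assume x: "x \<in> \<Sigma> t"
  then have x1: "x \<bullet> \<nu> > 0" "x \<bullet> e > t" by (auto simp: \<Sigma>_def)
  have "isCont (\<lambda>s. mirror e s x) t" unfolding mirror_def by (intro continuous_intros)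
  then have "isCont (\<lambda>s. v (mirror e s x)) t"
    by (rule isCont_o2) (intro isCont_v, simp add: mirror_simps x1)
  then have "((\<lambda>s. v (mirror e s x)) \<longlongrightarrow> v (mirror e t x)) (at_right t)"
    by (auto simp: isCont_def intro: tendsto_within_subset)
  moreover have "\<forall>\<^sub>F s in at_right t. v x \<le> v (mirror e s x)"
    using eventually_at_right_less[of t] order_tendstoD(2)[OF tendsto_ident_at x1(2), of "{t<..}"]
  proof eventually_elim
    case (elim s)
    then show ?case using good[of s] x1 by (auto simp: good_def \<Sigma>_def)
  qed
  ultimately show "v x \<le> v (mirror e t x)" by (rule tendsto_lowerbound) simp
qed

text \<open>The difference is nonnegative, and superharmonic because \<open>s powr p\<close> is
  increasing in \<open>s\<close>. On the convex set \<open>\<Sigma> t\<close> it is positive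
  everywhere or zero everywhere, and \<open>asym\<close> excludes the latter.\<close>

lemma good_strict:
  assumes t: "t > 0" and good: "good t" and x: "x \<in> \<Sigma> t"
  shows "v x < v (mirror e t x)"
proof -
  obtain x0 where "x0 \<in> \<Sigma> t" "v x0 \<noteq> v (mirror e t x0)"
    using asym[OF t] by (auto simp: \<Sigma>_def)
  moreover from this have "v x0 \<le> v (mirror e t x0)" using good by (auto simp: good_def)
  ultimately have x0: "x0 \<in> \<Sigma> t" "v (mirror e t x0) - v x0 > 0" by auto
  have "0 < v (mirror e t x) - v x"
  proof (rule strong_maximum_principle[where W="\<lambda>x. v (mirror e t x) - v x", OF open_\<Sigma> _ _ x0 x])
    have "\<Sigma> t = {x. \<nu> \<bullet> x > 0} \<inter> {x. e \<bullet> x > t}" by (auto simp: \<Sigma>_def inner_commute)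
    then show "connected (\<Sigma> t)"
      by (simp add: convex_connected convex_Int convex_halfspace_gt)
  next
    fix y assume y: "y \<in> \<Sigma> t"
    then have y1: "y \<bullet> \<nu> > 0" and le: "v y \<le> v (mirror e t y)" using good by (auto simp: \<Sigma>_def good_def)
    have "v y powr p \<le> v (mirror e t y) powr p"
      using le nonneg'[OF y1] p_gt by (intro powr_mono2) auto
    then have "N * (v y powr p - v (mirror e t y) powr p) \<le> 0"
      using N by (simp add: mult_le_0_iff)
    then show "0 \<le> v (mirror e t y) - v y \<and> (\<exists>d L. has_lap (\<lambda>y. v (mirror e t y) - v y) d L y \<and> L \<le> 0)"
      using pde_diff[OF y1, of t] le by auto
  qed
  then show ?thesis by simp
qed

text \<open>On a large compact part of \<open>\<Sigma> t0\<close> the strict inequality is stable; what remains lies far out,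
  where the Hardy term dominates the potential, or in a thin layer along the boundary, where the
  concave exponential factors do.\<close>

lemma good_open:
  assumes t0: "t0 > 0" and good: "good t0"
  shows "\<exists>\<delta>>0. \<forall>t. t0 - \<delta> < t \<longrightarrow> t < t0 \<longrightarrow> good t"
proof -
  obtain M where M: "\<And>x. x \<bullet> \<nu> \<ge> 0 \<Longrightarrow> x \<bullet> e \<ge> t0 / 2 \<Longrightarrow> v x \<le> M"
    using bounded_v[OF half_gt_zero[OF t0]] by blast
  obtain R where R: "R > 0" "\<And>x. x \<bullet> \<nu> > 0 \<Longrightarrow> norm x \<ge> R \<Longrightarrow>
      N * p * v x powr (p - 1) < \<alpha>\<^sup>2 / (norm x)\<^sup>2"
    using far_potential by blast
  define B where "B = N * p * M powr (p - 1)"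
  \<comment> \<open>Solves \<open>l\<^sup>2 / 4 * exp (- 2) = B + 1\<close>, which exceeds the bound
    \<open>B\<close> of the potential. The exponent is \<open>- 2\<close> because the layers will
    have width at most \<open>2 / l\<close>, measured from the boundary or from the moved
    plane.\<close>
  define l where "l = sqrt (4 * exp 2 * (B + 1))"
  have B: "B \<ge> 0" unfolding B_def using N p_gt by (intro mult_nonneg_nonneg) auto
  have l: "l > 0" "l\<^sup>2 / 4 * exp (- 2) = B + 1"
  proof -
    have pos: "4 * exp 2 * (B + 1) > 0" using B by (intro mult_pos_pos) auto
    then show "l > 0" by (simp add: l_def)
    have "l\<^sup>2 = 4 * exp 2 * (B + 1)" unfolding l_def using pos by (intro real_sqrt_pow2) simp
    then show "l\<^sup>2 / 4 * exp (- 2) = B + 1" by (simp add: exp_minus)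
  qed
  define \<eta> where "\<eta> = 1 / l"
  have \<eta>: "\<eta> > 0" "l * \<eta> = 1" using l(1) by (auto simp: \<eta>_def)
  define K where "K = {x. x \<bullet> \<nu> \<ge> \<eta>} \<inter> {x. x \<bullet> e \<ge> t0 + \<eta>} \<inter> cball 0 R"
  have K: "compact K" unfolding K_def
    by (intro closed_Int_compact closed_Int closed_Collect_le continuous_intros compact_cball)
  have Kpos: "x \<bullet> \<nu> > 0" "x \<in> \<Sigma> t0" if "x \<in> K" for x
    using that \<eta>(1) by (auto simp: K_def \<Sigma>_def)
  \<comment> \<open>Plane and point vary jointly, so that the tube lemma over the compact set
    \<open>K\<close> yields a \<open>\<delta>\<close> uniform in \<open>x\<close>.\<close>
  define h where "h = (\<lambda>(t, x). v (mirror e t x) - v x)"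
  have hc: "continuous_on (UNIV \<times> K) h"
  proof -
    have v: "continuous_on {x. x \<bullet> \<nu> > 0} v"
      using isCont_v by (intro continuous_at_imp_continuous_on) auto
    show ?thesis
      unfolding h_def case_prod_unfold
    proof (intro continuous_on_diff)
      show "continuous_on (UNIV \<times> K) (\<lambda>x. v (mirror e (fst x) (snd x)))"
        by (rule continuous_on_compose2[OF v])
           (auto simp: mirror_simps Kpos mirror_def[abs_def] inner_add_left orth intro!: continuous_intros)
      show "continuous_on (UNIV \<times> K) (\<lambda>x. v (snd x))"
        by (rule continuous_on_compose2[OF v]) (auto simp: Kpos intro!: continuous_intros)
    qed
  qed
  have hpos: "h (t0, x) > 0" if "x \<in> K" for x
    using good_strict[OF t0 good Kpos(2)[OF that]] by (simp add: h_def)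
  have "\<exists>\<delta>>0. \<forall>t x. \<bar>t - t0\<bar> < \<delta> \<longrightarrow> x \<in> K \<longrightarrow> h (t, x) > 0"
  proof -
    have "openin (top_of_set (UNIV \<times> K)) ((UNIV \<times> K) \<inter> h -` {0<..})"
      using hc by (intro continuous_openin_preimage_gen) auto
    then obtain \<Omega> where \<Omega>: "open \<Omega>" "(UNIV \<times> K) \<inter> h -` {0<..} = (UNIV \<times> K) \<inter> \<Omega>"
      unfolding openin_open by blast
    have "{t0} \<times> K \<subseteq> \<Omega>" using hpos \<Omega>(2) by auto
    then obtain X where X: "open X" "t0 \<in> X" "X \<times> K \<subseteq> \<Omega>"
      using Elementary_Topology.tube_lemma[OF K \<Omega>(1)] by blast
    obtain \<delta> where \<delta>: "\<delta> > 0" "ball t0 \<delta> \<subseteq> X" using X openE by blast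
    have "h (t, x) > 0" if "\<bar>t - t0\<bar> < \<delta>" "x \<in> K" for t x
    proof -
      have "t \<in> X" using that(1) \<delta>(2) by (auto simp: dist_real_def abs_minus_commute)
      then have "(t, x) \<in> (UNIV \<times> K) \<inter> \<Omega>" using X(3) that(2) by auto
      then show ?thesis unfolding \<Omega>(2)[symmetric] by simp
    qed
    then show ?thesis using \<delta>(1) by blast
  qed
  then obtain \<delta> where \<delta>: "\<delta> > 0" "\<And>t x. \<bar>t - t0\<bar> < \<delta> \<Longrightarrow> x \<in> K \<Longrightarrow> h (t, x) > 0" by blast
  \<comment> \<open>\<open>\<eta>\<close> keeps the layer \<open>x \<bullet> e < t0 + \<eta>\<close>
    within \<open>2 * \<eta>\<close> of the moved plane; \<open>t0 / 2\<close> keeps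
    \<open>t\<close> positive and in the range of the bound \<open>M\<close>.\<close>
  define \<delta>' where "\<delta>' = min \<delta> (min \<eta> (t0 / 2))"
  have \<delta>': "\<delta>' > 0" using \<delta> \<eta> t0 by (simp add: \<delta>'_def)
  have "good t" if t: "t0 - \<delta>' < t" "t < t0" for t
  proof (rule comparison[OF _ l(1)])
    have tt: "t > t0 / 2" "t > t0 - \<eta>" "\<bar>t - t0\<bar> < \<delta>" using t by (auto simp: \<delta>'_def)
    then show tp: "t > 0" using t0 by simp
    fix x assume x: "x \<in> \<Sigma> t" and gt: "v x > v (mirror e t x)"
    have x1: "x \<bullet> \<nu> > 0" "x \<bullet> e > t" using x by (auto simp: \<Sigma>_def)
    have "x \<notin> K" using \<delta>(2)[OF tt(3), of x] gt by (auto simp: h_def)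
    then consider "norm x \<ge> R" | "x \<bullet> \<nu> < \<eta>" | "x \<bullet> e < t0 + \<eta>"
      by (fastforce simp: K_def)
    then show "N * p * v x powr (p - 1) <
      \<alpha>\<^sup>2 / (norm x)\<^sup>2 + l\<^sup>2 / 4 * (exp (- l * (x \<bullet> \<nu>)) + exp (- l * (x \<bullet> e - t)))"
    proof cases
      case 1
      show ?thesis by (rule less_le_trans[OF R(2)[OF x1(1) 1]]) auto
    next
      case 2
      then have "l * (x \<bullet> \<nu>) \<le> l * \<eta>" using l(1) by (intro mult_left_mono) auto
      then have "- 2 \<le> - l * (x \<bullet> \<nu>)" using \<eta>(2) by simp
      then have "exp (- 2) \<le> exp (- l * (x \<bullet> \<nu>))" by (simp only: exp_le_cancel_iff)
      then have e: "exp (- 2) \<le> exp (- l * (x \<bullet> \<nu>)) + exp (- l * (x \<bullet> e - t))"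
        by (smt (verit) exp_gt_zero)
      have "N * p * v x powr (p - 1) \<le> B"
        unfolding B_def using N p_gt M[of x] nonneg'[OF x1(1)] x1 tt
        by (intro mult_left_mono powr_mono2) auto
      also have "\<dots> < l\<^sup>2 / 4 * exp (- 2)" unfolding l(2) by simp
      also have "\<dots> \<le> l\<^sup>2 / 4 * (exp (- l * (x \<bullet> \<nu>)) + exp (- l * (x \<bullet> e - t)))"
        using e by (intro mult_left_mono) auto
      also have "\<dots> \<le> \<alpha>\<^sup>2 / (norm x)\<^sup>2 + \<dots>" by simp
      finally show ?thesis .
    next
      case 3
      then have "x \<bullet> e - t \<le> 2 * \<eta>" using tt(2) by simp
      then have "l * (x \<bullet> e - t) \<le> l * (2 * \<eta>)" using l(1) by (intro mult_left_mono) auto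
      then have "l * (x \<bullet> e - t) \<le> 2" using \<eta>(2) by simp
      then have "- 2 \<le> - l * (x \<bullet> e - t)" by simp
      then have "exp (- 2) \<le> exp (- l * (x \<bullet> e - t))" by (simp only: exp_le_cancel_iff)
      then have e: "exp (- 2) \<le> exp (- l * (x \<bullet> \<nu>)) + exp (- l * (x \<bullet> e - t))"
        by (smt (verit) exp_gt_zero)
      have "N * p * v x powr (p - 1) \<le> B"
        unfolding B_def using N p_gt M[of x] nonneg'[OF x1(1)] x1 tt
        by (intro mult_left_mono powr_mono2) auto
      also have "\<dots> < l\<^sup>2 / 4 * exp (- 2)" unfolding l(2) by simp
      also have "\<dots> \<le> l\<^sup>2 / 4 * (exp (- l * (x \<bullet> \<nu>)) + exp (- l * (x \<bullet> e - t)))"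
        using e by (intro mult_left_mono) auto
      also have "\<dots> \<le> \<alpha>\<^sup>2 / (norm x)\<^sup>2 + \<dots>" by simp
      finally show ?thesis .
    qed
  qed
  then show ?thesis using \<delta>' by blast
qed

text \<open>A positive infimum of admissible positions would itself be admissible by
  \<open>good_limit\<close>, and could then be lowered by \<open>good_open\<close>.\<close>

lemma all_good:
  assumes "t > 0"
  shows "good t"
proof -
  define A where "A = {t. t > 0 \<and> (\<forall>s\<ge>t. good s)}"
  define t0 where "t0 = Inf A"
  have ne: "A \<noteq> {}" using good_large unfolding A_def by blast
  have bdd: "bdd_below A" by (rule bdd_belowI[of _ 0]) (auto simp: A_def)
  have gt: "good s" if s: "s > t0" for s
  proof -
    obtain a where "a \<in> A" "a < s" using s cInf_less_iff[OF ne bdd] by (auto simp: t0_def)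
    then show ?thesis by (auto simp: A_def)
  qed
  have "t0 \<le> 0"
  proof (rule ccontr)
    assume "\<not> t0 \<le> 0"
    then have t0: "t0 > 0" by simp
    have g0: "good t0" using gt by (rule good_limit)
    obtain \<delta> where \<delta>: "\<delta> > 0" "\<And>t. t0 - \<delta> < t \<Longrightarrow> t < t0 \<Longrightarrow> good t"
      using good_open[OF t0 g0] by blast
    define t1 where "t1 = max (t0 / 2) (t0 - \<delta> / 2)"
    have t1: "0 < t1" "t1 < t0" "t0 - \<delta> < t1" using t0 \<delta> by (auto simp: t1_def)
    have "good s" if "s \<ge> t1" for s
    proof (cases s t0 rule: linorder_cases)
      case less
      then show ?thesis using \<delta>(2)[of s] that t1 by linarith
    qed (use gt g0 in simp_all)
    then have "t1 \<in> A" using t1 by (auto simp: A_def)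
    then have "t0 \<le> t1" unfolding t0_def using bdd by (rule cInf_lower)
    then show False using t1 by simp
  qed
  then show ?thesis using gt assms by simp
qed

lemma mirror_0_le:
  assumes "x \<bullet> \<nu> > 0" "x \<bullet> e > 0"
  shows "v x \<le> v (mirror e 0 x)"
proof -
  have "good 0" by (rule good_limit) (rule all_good)
  then show ?thesis using assms by (auto simp: good_def \<Sigma>_def)
qed

end

section \<open>Reflections of the singular solution\<close>

text \<open>Coordinate-free form of the problem with inner normal \<open>\<nu>\<close>. Since
  \<open>u\<close> vanishes on the punctured boundary, non-removability is expressed as failure to
  tend to 0 from inside.\<close>

locale singular_solution =
  fixes u :: "'a::euclidean_space \<Rightarrow> real" and \<nu> :: 'a and N p n :: real
  assumes n_def: "n = real DIM('a)" and n_ge: "n \<ge> 3"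
    and \<nu>: "norm \<nu> = 1"
    and cont: "continuous_on ({x. x \<bullet> \<nu> \<ge> 0} - {0}) u"
    and nonneg: "\<And>x. x \<bullet> \<nu> \<ge> 0 \<Longrightarrow> x \<noteq> 0 \<Longrightarrow> u x \<ge> 0"
    and bdry: "\<And>x. x \<bullet> \<nu> = 0 \<Longrightarrow> x \<noteq> 0 \<Longrightarrow> u x = 0"
    and N: "N > 0" and p: "p = (n + 2) / (n - 2)"
    and pde: "\<And>x. x \<bullet> \<nu> > 0 \<Longrightarrow> \<exists>d. has_lap u d (- N * u x powr p) x"
    and singular: "\<not> (u \<longlongrightarrow> 0) (at 0 within {x. x \<bullet> \<nu> > 0})"
begin

lemma isCont_u: "x \<bullet> \<nu> > 0 \<Longrightarrow> isCont u x"
  using pde has_lap_isCont by blast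

lemma eventually_half_space: "\<forall>\<^sub>F x in at y within {x. x \<bullet> \<nu> > 0}. x \<bullet> \<nu> > 0"
  by (simp add: eventually_at_filter)

text \<open>\<open>K\<close> inverts \<open>T\<close>. The reflection in the hyperplane through 0
  preserves norms, so it commutes with the inversion and leaves the weight unchanged; the inequality
  for \<open>v\<close> at \<open>t = 0\<close> is thus the one for \<open>u\<close> at the plane
  \<open>a\<close>.\<close>

lemma reflection_inequality:
  assumes e: "norm e = 1" "e \<bullet> \<nu> = 0" and a: "a > 0" and y: "y \<bullet> \<nu> > 0" "y \<bullet> e > a"
  shows "u y \<le> u (mirror e a y)"
proof -
  define T where "T z = a *\<^sub>R e + z /\<^sub>R (z \<bullet> z)" for z
  define K where "K y = (y - a *\<^sub>R e) /\<^sub>R ((y - a *\<^sub>R e) \<bullet> (y - a *\<^sub>R e))" for y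
  define v where "v z = norm z powr (2 - n) * u (T z)" for z
  \<comment> \<open>The point that \<open>T\<close> sends to 0, so the image of the singularity; the
    other singular point 0 is the image of infinity.\<close>
  define q where "q = - (1 / a) *\<^sub>R e"
  have ee: "e \<bullet> e = 1" using e by (simp add: dot_square_norm)
  have T\<nu>: "T z \<bullet> \<nu> = (z \<bullet> \<nu>) / (z \<bullet> z)" for z
    using e by (simp add: T_def inner_add_left divide_inverse mult.commute)
  have T0: "T z \<noteq> 0" if "z \<noteq> 0" "z \<noteq> q" for z
  proof
    assume "T z = 0"
    then have "z /\<^sub>R (z \<bullet> z) = - a *\<^sub>R e" by (simp add: T_def eq_neg_iff_add_eq_0 add.commute)
    then have "(z \<bullet> z) *\<^sub>R (z /\<^sub>R (z \<bullet> z)) = (z \<bullet> z) *\<^sub>R (- a *\<^sub>R e)" by simp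
    then have z: "z = (- a * (z \<bullet> z)) *\<^sub>R e" using that by (simp add: mult.commute)
    then have "z \<bullet> z = (- a * (z \<bullet> z)) * (- a * (z \<bullet> z))"
      using ee by (metis inner_scaleR_left inner_scaleR_right mult.right_neutral mult.assoc)
    then have "a * (a * (z \<bullet> z)) = 1" using that by (simp add: mult.assoc mult.left_commute)
    then have "a * (z \<bullet> z) = 1 / a" using a by (simp add: field_simps)
    then show False using z that(2) by (simp add: q_def)
  qed
  have Tcont: "isCont T z" if "z \<noteq> 0" for z
    unfolding T_def using that by (intro continuous_intros) auto
  have Kcont: "isCont K z" if "z \<noteq> a *\<^sub>R e" for z
    unfolding K_def using that by (intro continuous_intros) auto
  have KK: "K z \<bullet> K z = inverse ((z - a *\<^sub>R e) \<bullet> (z - a *\<^sub>R e))" if "z \<noteq> a *\<^sub>R e" for z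
    using that unfolding K_def inner_scaleR_left inner_scaleR_right by (simp add: field_simps)
  have TK: "T (K z) = z" if "z \<noteq> a *\<^sub>R e" for z
    unfolding T_def KK[OF that] using that by (simp add: K_def)
  have K\<nu>: "K z \<bullet> \<nu> > 0" "z \<noteq> a *\<^sub>R e" "K z \<noteq> 0" if "z \<bullet> \<nu> > 0" for z
  proof -
    show ne: "z \<noteq> a *\<^sub>R e" using that e by auto
    have "(z - a *\<^sub>R e) \<bullet> \<nu> > 0" using that e by (simp add: inner_diff_left)
    moreover have "(z - a *\<^sub>R e) \<bullet> (z - a *\<^sub>R e) > 0" using ne by (simp only: inner_gt_zero_iff) simp
    ultimately show "K z \<bullet> \<nu> > 0"
      unfolding K_def inner_scaleR_left by (intro mult_pos_pos positive_imp_inverse_positive)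
    then show "K z \<noteq> 0" by auto
  qed
  have uK: "u z = norm (K z) powr (n - 2) * v (K z)" if "z \<bullet> \<nu> > 0" for z
    using K\<nu>[OF that] TK[of z] by (simp add: v_def powr_add[symmetric] mult.assoc[symmetric])
  \<comment> \<open>As \<open>u\<close> is continuous and zero at \<open>a *\<^sub>R e\<close>, it
    is below 1 nearby. Inversion turns this into the decay of \<open>v\<close> with constant
    \<open>1\<close> beyond radius \<open>2 / r\<close>, where the 2 makes
    \<open>inverse (norm x) < r\<close> strict.\<close>
  have near: "\<exists>r>0. \<forall>y. y \<bullet> \<nu> \<ge> 0 \<longrightarrow> y \<noteq> 0 \<longrightarrow> dist y (a *\<^sub>R e) < r \<longrightarrow> u y < 1"
  proof -
    have "a *\<^sub>R e \<in> {x. x \<bullet> \<nu> \<ge> 0} - {0}" "u (a *\<^sub>R e) = 0"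
      using e a ee bdry[of "a *\<^sub>R e"] by fastforce+
    then show ?thesis using cont[unfolded continuous_on_iff, rule_format, of "a *\<^sub>R e" 1]
      by (force simp: dist_real_def)
  qed
  then obtain r where r: "r > 0" "\<And>y. y \<bullet> \<nu> \<ge> 0 \<Longrightarrow> y \<noteq> 0 \<Longrightarrow> dist y (a *\<^sub>R e) < r \<Longrightarrow> u y < 1"
    by blast
  have vcont: "continuous_on ({x. x \<bullet> \<nu> \<ge> 0} - {0, q}) v"
    unfolding v_def
  proof (intro continuous_on_mult continuous_on_compose2[OF cont])
    show "continuous_on ({x. x \<bullet> \<nu> \<ge> 0} - {0, q}) T"
      using Tcont by (intro continuous_at_imp_continuous_on) auto
    show "T ` ({x. x \<bullet> \<nu> \<ge> 0} - {0, q}) \<subseteq> {x. x \<bullet> \<nu> \<ge> 0} - {0}"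
      using T0 by (auto simp: T\<nu>)
  qed (intro continuous_intros, auto)
  have vbdry: "v x = 0" if "x \<bullet> \<nu> = 0" "x \<notin> {0, q}" for x
    using bdry[of "T x"] T0[of x] that by (auto simp: v_def T\<nu>)
  interpret v: half_space_solution v \<nu> e "{0, q}" N 1 "2 / r" p n
  proof
    show "s \<bullet> \<nu> = 0 \<and> s \<bullet> e \<le> 0" if "s \<in> {0, q}" for s
      using that e ee a by (auto simp: q_def)
    show "continuous_on ({x. x \<bullet> \<nu> \<ge> 0} - {0, q}) v" by (rule vcont)
    show "v x \<ge> 0" if "x \<bullet> \<nu> \<ge> 0" "x \<notin> {0, q}" for x
      using nonneg[of "T x"] T0[of x] that by (auto simp: v_def T\<nu>)
    show "v x = 0" if "x \<bullet> \<nu> = 0" "x \<notin> {0, q}" for x using that by (rule vbdry)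
    show "\<exists>d. has_lap v d (- N * v x powr p) x" if x: "x \<bullet> \<nu> > 0" for x
    proof -
      have x0: "x \<noteq> 0" using x by auto
      have Tx: "T x \<bullet> \<nu> > 0" using x x0 by (simp add: T\<nu>)
      then have uT: "u (T x) \<ge> 0" using nonneg[of "T x"] by fastforce
      obtain d where "has_lap u d (- N * u (T x) powr p) (T x)" using pde[OF Tx] by blast
      from has_lap_kelvin[OF x0 this[unfolded T_def]]
      have "\<exists>d. has_lap v d (norm x powr (- 2 - n) * (- N * u (T x) powr p)) x"
        unfolding v_def[abs_def] T_def n_def .
      \<comment> \<open>Here \<open>p\<close> has to be critical:
        \<open>(2 - n) * p = - 2 - n\<close> makes the weight of the transformed right-hand side the
        \<open>p\<close>-th power of the weight of \<open>v\<close>.\<close>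
      moreover have "norm x powr (- 2 - n) = (norm x powr (2 - n)) powr p"
      proof -
        have "(2 - n) * p = - 2 - n" using n_ge by (simp add: p field_simps)
        then show ?thesis by (simp add: powr_powr)
      qed
      ultimately show ?thesis by (simp add: v_def powr_mult uT mult.left_commute)
    qed
    show "v x \<le> 1 * norm x powr (2 - n)"
      if x: "x \<bullet> \<nu> \<ge> 0" "x \<notin> {0, q}" "norm x \<ge> 2 / r" for x
    proof -
      have x0: "x \<noteq> 0" using x by auto
      have "dist (T x) (a *\<^sub>R e) = inverse (norm x)"
        using x0 by (simp add: T_def dist_norm dot_square_norm power2_eq_square)
      also have "\<dots> < r" using x(3) x0 r(1) by (simp add: field_simps)
      finally have "u (T x) < 1" using r(2)[of "T x"] T0[of x] x by (auto simp: T\<nu>)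
      then show ?thesis using x0 by (simp add: v_def mult_left_le)
    qed
    \<comment> \<open>Under symmetry, \<open>v\<close> near \<open>q\<close> would repeat its values
      near \<open>mirror e t q\<close>, a regular boundary point because \<open>t > 0\<close>. So
      \<open>v\<close> would tend to 0 at \<open>q\<close>, and \<open>u\<close> at 0.\<close>
    show "\<exists>x. x \<bullet> \<nu> > 0 \<and> x \<bullet> e > t \<and> v x \<noteq> v (mirror e t x)" if t: "t > 0" for t
    proof (rule ccontr)
      assume "\<not> ?thesis"
      then have sym: "\<And>x. x \<bullet> \<nu> > 0 \<Longrightarrow> x \<bullet> e > t \<Longrightarrow> v x = v (mirror e t x)" by blast
      have mm: "mirror e t (mirror e t x) = x" "mirror e t x \<bullet> \<nu> = x \<bullet> \<nu>"
        "mirror e t x \<bullet> e = 2 * t - x \<bullet> e" for x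
        using ee e by (auto simp: mirror_def inner_add_left algebra_simps)
      let ?F = "at 0 within {x. x \<bullet> \<nu> > 0}"
      have K0: "K 0 = q"
        using a ee by (simp add: K_def q_def field_simps)
      have ae: "0 \<noteq> a *\<^sub>R e" using a e by auto
      have Klim: "(K \<longlongrightarrow> q) ?F"
        using Kcont[OF ae] K0 by (auto simp: isCont_def intro: tendsto_within_subset)
      have "isCont (mirror e t) q" by (rule continuous_mirror)
      then have mlim: "((\<lambda>z. mirror e t (K z)) \<longlongrightarrow> mirror e t q) ?F"
        using Klim by (rule isCont_tendsto_compose)
      have mq: "mirror e t q \<in> {x. x \<bullet> \<nu> \<ge> 0} - {0, q}" "v (mirror e t q) = 0"
      proof -
        have qe: "q \<bullet> e < 0" "q \<bullet> \<nu> = 0" using a ee e by (auto simp: q_def)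
        then have "mirror e t q \<bullet> e > 0" using t by (simp add: mm)
        then have "mirror e t q \<notin> {0, q}" using qe by auto
        then show "mirror e t q \<in> {x. x \<bullet> \<nu> \<ge> 0} - {0, q}" "v (mirror e t q) = 0"
          using qe by (auto simp: mm intro: vbdry)
      qed
      have evm: "\<forall>\<^sub>F z in ?F. mirror e t (K z) \<in> {x. x \<bullet> \<nu> \<ge> 0} - {0, q}"
        using eventually_half_space
      proof eventually_elim
        case (elim z)
        have "mirror e t (K z) \<bullet> \<nu> > 0" "q \<bullet> \<nu> = 0" using K\<nu>[OF elim] e by (auto simp: mm q_def)
        then show ?case by auto
      qed
      have vlim: "((\<lambda>z. v (mirror e t (K z))) \<longlongrightarrow> 0) ?F"
        using continuous_on_tendsto_compose[OF vcont mlim mq(1) evm] mq(2) by simp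
      have "q \<noteq> 0" using a e by (auto simp: q_def)
      then have "((\<lambda>z. norm (K z) powr (n - 2) * v (mirror e t (K z))) \<longlongrightarrow> norm q powr (n - 2) * 0) ?F"
        by (intro tendsto_intros vlim Klim) auto
      then have "((\<lambda>z. norm (K z) powr (n - 2) * v (mirror e t (K z))) \<longlongrightarrow> 0) ?F" by simp
      moreover have "\<forall>\<^sub>F z in ?F. norm (K z) powr (n - 2) * v (mirror e t (K z)) = u z"
      proof -
        have "((\<lambda>z. K z \<bullet> e) \<longlongrightarrow> q \<bullet> e) ?F" by (intro tendsto_intros Klim)
        moreover have "q \<bullet> e < t"
        proof -
          have "q \<bullet> e = - (1 / a)" using ee by (simp add: q_def)
          also have "\<dots> < 0" using a by simp
          finally show ?thesis using t by simp
        qed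
        ultimately have "\<forall>\<^sub>F z in ?F. K z \<bullet> e < t" by (rule order_tendstoD(2))
        then show ?thesis using eventually_half_space
        proof eventually_elim
          case (elim z)
          have "v (mirror e t (K z)) = v (K z)"
            using sym[of "mirror e t (K z)"] elim(1) K\<nu>[OF elim(2)] by (simp add: mm)
          then show ?case using uK[OF elim(2)] by simp
        qed
      qed
      ultimately have "(u \<longlongrightarrow> 0) ?F" by (rule Lim_transform_eventually)
      then show False using singular by blast
    qed
  qed (use n_def n_ge \<nu> e N p r in auto)
  have ye: "y \<noteq> a *\<^sub>R e" "K y \<bullet> \<nu> > 0" "K y \<noteq> 0" using K\<nu>[OF y(1)] by auto
  have "(y - a *\<^sub>R e) \<bullet> e > 0" using y(2) ee by (simp add: inner_diff_left)
  moreover have "(y - a *\<^sub>R e) \<bullet> (y - a *\<^sub>R e) > 0" using ye(1) by (simp only: inner_gt_zero_iff) simp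
  ultimately have "K y \<bullet> e > 0"
    unfolding K_def inner_scaleR_left by (intro mult_pos_pos positive_imp_inverse_positive)
  from v.mirror_0_le[OF ye(2) this] have le: "v (K y) \<le> v (mirror e 0 (K y))" .
  have nm: "mirror e 0 (K y) \<bullet> mirror e 0 (K y) = K y \<bullet> K y"
    using ee by (simp add: mirror_def inner_add_left inner_add_right inner_commute algebra_simps power2_eq_square)
  have "T (mirror e 0 (K y)) = mirror e a (T (K y))"
    unfolding T_def nm
    using ee by (simp add: mirror_def inner_add_left scaleR_add_right algebra_simps)
  then have "T (mirror e 0 (K y)) = mirror e a y" using TK[OF ye(1)] by simp
  moreover have "norm (mirror e 0 (K y)) = norm (K y)" using nm by (simp add: norm_eq)
  ultimately show ?thesis
    using le ye(3) TK[OF ye(1)] by (simp add: v_def)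
qed

text \<open>Equality throughout the region beyond the plane would equate \<open>u\<close> near 0
  with \<open>u\<close> near the regular boundary point \<open>(2 * a) *\<^sub>R e\<close>, where it
  tends to 0. The second claim prepares Hopf's lemma.\<close>

lemma reflection_strict:
  assumes e: "norm e = 1" "e \<bullet> \<nu> = 0" and a: "a > 0" and y: "y \<bullet> \<nu> > 0" "y \<bullet> e > a"
  shows "u y < u (mirror e a y)"
    and "\<exists>d L. has_lap (\<lambda>y. u (mirror e a y) - u y) d L y \<and> L \<le> 0"
proof -
  define U where "U = {x. x \<bullet> \<nu> > 0} \<inter> {x. x \<bullet> e > a}"
  have ee: "e \<bullet> e = 1" using e by (simp add: dot_square_norm)
  have mm: "mirror e a x \<bullet> \<nu> = x \<bullet> \<nu>" "mirror e a (mirror e a x) = x" "mirror e a x \<bullet> e = 2 * a - x \<bullet> e" for x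
    using e ee by (auto simp: mirror_def inner_add_left algebra_simps)
  have U: "open U" unfolding U_def by (intro open_Int open_Collect_less continuous_intros)
  have Uc: "connected U"
  proof -
    have "U = {x. \<nu> \<bullet> x > 0} \<inter> {x. e \<bullet> x > a}" by (auto simp: U_def inner_commute)
    then show ?thesis by (simp add: convex_connected convex_Int convex_halfspace_gt)
  qed
  have sup: "u (mirror e a x) - u x \<ge> 0 \<and> (\<exists>d L. has_lap (\<lambda>y. u (mirror e a y) - u y) d L x \<and> L \<le> 0)"
    if "x \<in> U" for x
  proof -
    have x: "x \<bullet> \<nu> > 0" "x \<bullet> e > a" using that by (auto simp: U_def)
    have le: "u x \<le> u (mirror e a x)" by (rule reflection_inequality[OF e a x])
    have "u x \<ge> 0" using nonneg[of x] x by fastforce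
    moreover have "p \<ge> 0" using n_ge by (simp add: p)
    ultimately have "u x powr p \<le> u (mirror e a x) powr p" using le by (intro powr_mono2)
    then have L: "- N * u (mirror e a x) powr p - (- N * u x powr p) \<le> 0" using N by simp
    obtain d1 where d1: "has_lap u d1 (- N * u x powr p) x" using pde[OF x(1)] by blast
    obtain d2 where d2: "has_lap u d2 (- N * u (mirror e a x) powr p) (mirror e a x)"
      using pde[of "mirror e a x"] x by (auto simp: mm)
    have "0 \<le> u (mirror e a x) - u x" using le by simp
    then show ?thesis using has_lap_diff[OF has_lap_mirror[OF e(1) d2] d1] L by blast
  qed
  show "\<exists>d L. has_lap (\<lambda>y. u (mirror e a y) - u y) d L y \<and> L \<le> 0"
    using sup[of y] y by (simp add: U_def)
  have "\<exists>x0\<in>U. u (mirror e a x0) - u x0 > 0"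
  proof (rule ccontr)
    assume neg: "\<not> ?thesis"
    have eq: "u (mirror e a x) = u x" if "x \<in> U" for x
      using neg sup[OF that] that by fastforce
    let ?F = "at 0 within {x. x \<bullet> \<nu> > 0}"
    have "mirror e a 0 = (2 * a) *\<^sub>R e" by (simp add: mirror_def)
    then have m0: "mirror e a 0 \<in> {x. x \<bullet> \<nu> \<ge> 0} - {0}" "u (mirror e a 0) = 0"
      using a e ee bdry[of "(2 * a) *\<^sub>R e"] by fastforce+
    have "((\<lambda>z. mirror e a z) \<longlongrightarrow> mirror e a 0) ?F"
      using continuous_mirror[of 0 e a] by (auto simp: isCont_def intro: tendsto_within_subset)
    moreover have "\<forall>\<^sub>F z in ?F. mirror e a z \<in> {x. x \<bullet> \<nu> \<ge> 0} - {0}"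
      using eventually_half_space
    proof eventually_elim
      case (elim z)
      then have "mirror e a z \<bullet> \<nu> > 0" by (simp add: mm)
      then show ?case by auto
    qed
    ultimately have "((\<lambda>z. u (mirror e a z)) \<longlongrightarrow> 0) ?F"
      using continuous_on_tendsto_compose[OF cont _ m0(1)] m0(2) by simp
    moreover have "\<forall>\<^sub>F z in ?F. u (mirror e a z) = u z"
    proof -
      have "((\<lambda>z. z \<bullet> e) \<longlongrightarrow> 0 \<bullet> e) ?F" by (intro tendsto_intros)
      then have "\<forall>\<^sub>F z in ?F. z \<bullet> e < a" using a by (intro order_tendstoD(2)[of _ "0 \<bullet> e"]) auto
      then show ?thesis using eventually_half_space
      proof eventually_elim
        case (elim z)
        then have "mirror e a z \<in> U" by (simp add: U_def mm)
        from eq[OF this] show ?case by (simp add: mm)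
      qed
    qed
    ultimately have "(u \<longlongrightarrow> 0) ?F" by (rule Lim_transform_eventually)
    then show False using singular by blast
  qed
  then obtain x0 where x0: "x0 \<in> U" "u (mirror e a x0) - u x0 > 0" by blast
  have "y \<in> U" using y by (simp add: U_def)
  from strong_maximum_principle[where W="\<lambda>x. u (mirror e a x) - u x", OF U Uc sup x0 this]
  show "u y < u (mirror e a y)" by simp
qed

text \<open>For the plane through \<open>y\<close> itself, \<open>u (mirror e a x) - u x\<close>
  vanishes at \<open>y\<close> and has derivative \<open>- 2 * D\<close> along
  \<open>e\<close>.\<close>

lemma derivative_neg:
  assumes e: "norm e = 1" "e \<bullet> \<nu> = 0" and y: "y \<bullet> \<nu> > 0" "y \<bullet> e > 0"
    and D: "((\<lambda>s. u (y + s *\<^sub>R e)) has_real_derivative D) (at 0)"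
  shows "D < 0"
proof -
  define a where "a = y \<bullet> e"
  have ee: "e \<bullet> e = 1" using e by (simp add: dot_square_norm)
  have m: "mirror e a (y + s *\<^sub>R e) = y + (- s) *\<^sub>R e" for s
    using ee by (simp add: mirror_def a_def inner_add_left scaleR_add_left[symmetric] algebra_simps)
  \<comment> \<open>The ball of radius \<open>y \<bullet> \<nu>\<close> has its centre at that same
    distance from the boundary and from the plane, so it lies inside the region beyond the plane and
    touches the plane at \<open>y\<close>.\<close>
  have "0 < - D - D"
  proof (rule hopf_half_line[where W="\<lambda>x. u (mirror e a x) - u x" and y=y and e=e and \<rho>="y \<bullet> \<nu>"])
    fix x assume x: "x \<in> ball (y + (y \<bullet> \<nu>) *\<^sub>R e) (y \<bullet> \<nu>)"
    define w where "w = x - (y + (y \<bullet> \<nu>) *\<^sub>R e)"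
    have w: "norm w < y \<bullet> \<nu>" using x by (simp add: w_def dist_norm norm_minus_commute)
    have "\<bar>w \<bullet> \<nu>\<bar> < y \<bullet> \<nu>" "\<bar>w \<bullet> e\<bar> < y \<bullet> \<nu>"
      using Cauchy_Schwarz_ineq2[of w \<nu>] Cauchy_Schwarz_ineq2[of w e] w \<nu> e by auto
    then have "x \<bullet> \<nu> > 0" "x \<bullet> e > a"
      using e ee by (auto simp: w_def a_def inner_diff_left inner_add_left)
    from reflection_strict[OF e _ this] y(2)
    show "0 < u (mirror e a x) - u x \<and> (\<exists>d L. has_lap (\<lambda>x. u (mirror e a x) - u x) d L x \<and> L \<le> 0)"
      by (simp add: a_def)
  next
    show "u (mirror e a y) - u y = 0" using m[of 0] by simp
    have "((\<lambda>s. u (y + (- s) *\<^sub>R e)) has_real_derivative D * - 1) (at 0)"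
      by (rule DERIV_chain2[of "\<lambda>s. u (y + s *\<^sub>R e)" D "\<lambda>s. - s" 0 "- 1" UNIV])
         (use D in \<open>auto intro!: derivative_eq_intros\<close>)
    from DERIV_diff[OF this D]
    show "((\<lambda>s. u (mirror e a (y + s *\<^sub>R e)) - u (y + s *\<^sub>R e)) has_real_derivative - D - D) (at 0)"
      unfolding m by simp
  qed (use y e in auto)
  then show ?thesis by simp
qed

lemma reflection_le:
  assumes e: "norm e = 1" "e \<bullet> \<nu> = 0" and y: "y \<bullet> \<nu> > 0" "y \<bullet> e > 0"
  shows "u y \<le> u (mirror e 0 y)"
proof -
  have "isCont (\<lambda>a. mirror e a y) 0" unfolding mirror_def by (intro continuous_intros)
  then have "isCont (\<lambda>a. u (mirror e a y)) 0"
    by (rule isCont_o2) (use y e in \<open>auto intro!: isCont_u simp: inner_mirror\<close>)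
  then have "((\<lambda>a. u (mirror e a y)) \<longlongrightarrow> u (mirror e 0 y)) (at_right 0)"
    by (auto simp: isCont_def intro: tendsto_within_subset)
  moreover have "\<forall>\<^sub>F a in at_right 0. u y \<le> u (mirror e a y)"
    using eventually_at_right_less[of 0] order_tendstoD(2)[OF tendsto_ident_at y(2), of "{0<..}"]
    by eventually_elim (rule reflection_inequality[OF e _ y(1)])
  ultimately show ?thesis by (rule tendsto_lowerbound) simp
qed

text \<open>At \<open>t = 0\<close> the vectors \<open>e\<close> and \<open>- e\<close> define the
  same reflection, so the inequality can be applied at \<open>y\<close> and at its mirror
  image.\<close>

lemma reflection_eq:
  assumes e: "norm e = 1" "e \<bullet> \<nu> = 0" and y: "y \<bullet> \<nu> > 0"
  shows "u (mirror e 0 y) = u y"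
proof -
  have ee: "e \<bullet> e = 1" using e by (simp add: dot_square_norm)
  have mm: "mirror e 0 x \<bullet> \<nu> = x \<bullet> \<nu>" "mirror e 0 (mirror e 0 x) = x" "mirror e 0 x \<bullet> e = - (x \<bullet> e)"
    "mirror (- e) 0 x = mirror e 0 x" for x
    using e ee by (auto simp: mirror_def inner_add_left algebra_simps)
  have me: "norm (- e) = 1" "(- e) \<bullet> \<nu> = 0" using e by auto
  consider "y \<bullet> e > 0" | "y \<bullet> e = 0" | "y \<bullet> e < 0" by linarith
  then show ?thesis
  proof cases
    case 1
    show ?thesis
      using reflection_le[OF e y 1] reflection_le[OF me, of "mirror e 0 y"] 1 y by (simp add: mm)
  next
    case 2
    then show ?thesis by (simp add: mirror_def)
  next
    case 3
    show ?thesis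
      using reflection_le[OF me y] reflection_le[OF e, of "mirror e 0 y"] 3 y by (simp add: mm)
  qed
qed

end

section \<open>The half space of pairs: removability and the radial profile\<close>

lemma half_space_eq: "half_space = {x::'m::finite space. (0, 1) \<bullet> x > 0}"
  by (auto simp: half_space_def)

lemma closure_half_space: "closure half_space = {x::'m::finite space. snd x \<ge> 0}"
  using closure_halfspace_gt[of "(0, 1) :: 'm space" 0] by (simp add: half_space_eq inner_prod_def zero_prod_def)

lemma frontier_half_space: "frontier half_space = {x::'m::finite space. snd x = 0}"
  using frontier_halfspace_gt[of "(0, 1) :: 'm space" 0] by (simp add: half_space_eq inner_prod_def zero_prod_def)

text \<open>If \<open>u\<close> tends to 0 from inside, the value 0 extends it continuously:
  \<open>u\<close> is 0 on the punctured frontier too, and the closure is the union of the half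
  space and its frontier.\<close>

lemma not_removable_imp_not_tendsto_0:
  fixes u :: "'m::finite space \<Rightarrow> real"
  assumes cont: "continuous_on (closure half_space - {0}) u"
    and bdry: "\<forall>x \<in> frontier half_space - {0}. u x = 0"
    and nr: "\<not> removable_at_0 u"
  shows "\<not> (u \<longlongrightarrow> 0) (at 0 within half_space)"
proof
  assume lim: "(u \<longlongrightarrow> 0) (at 0 within half_space)"
  define v where "v x = (if x = 0 then 0 else u x)" for x
  have "continuous_on (closure half_space) v"
    unfolding continuous_on_def
  proof
    fix x :: "'m space" assume x: "x \<in> closure half_space"
    show "(v \<longlongrightarrow> v x) (at x within closure half_space)"
    proof (cases "x = 0")
      case False
      then have "(u \<longlongrightarrow> u x) (at x within (closure half_space - {0}))"
        using cont x by (auto simp: continuous_on_def)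
      then have "(u \<longlongrightarrow> u x) (at x within closure half_space)"
        using at_within_nhd[of x "- {0}" "closure half_space - {0}" "closure half_space"] False
        by (simp add: Diff_eq Int_assoc open_Compl)
      moreover have "\<forall>\<^sub>F y in at x within closure half_space. u y = v y"
        using eventually_neq_at_within[of 0 x] by eventually_elim (simp add: v_def)
      ultimately show ?thesis using False by (simp add: v_def Lim_transform_eventually)
    next
      case True
      have "(v \<longlongrightarrow> 0) (at 0 within half_space)"
      proof (rule Lim_transform_eventually[OF lim])
        show "\<forall>\<^sub>F y in at 0 within half_space. u y = v y"
          by (simp add: eventually_at_filter v_def)
      qed
      moreover have "(v \<longlongrightarrow> 0) (at 0 within frontier half_space)"
      proof (rule Lim_transform_eventually[OF tendsto_const])
        show "\<forall>\<^sub>F y in at 0 within frontier half_space. 0 = v y"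
          using bdry by (simp add: eventually_at_filter v_def)
      qed
      moreover have "closure half_space = (half_space \<union> frontier half_space :: 'm space set)"
        unfolding closure_half_space frontier_half_space by (auto simp: half_space_def)
      ultimately show ?thesis
        using True by (simp add: Lim_within_Un v_def)
    qed
  qed
  then have "removable_at_0 u" unfolding removable_at_0_def by (intro exI[of _ v]) (auto simp: v_def)
  then show False using nr by simp
qed

theorem proposition1p1:
  fixes u :: "('m::finite) space \<Rightarrow> real" and n :: nat
  assumes n_def: "n = DIM('m space)"
    and n_ge: "n \<ge> 3"
    and C2: "Ck_on 2 u half_space"
    and cont: "continuous_on (closure half_space - {0}) u"
    and nonneg: "\<forall>x \<in> closure half_space - {0}. u x \<ge> 0"
    and pde: "\<forall>x \<in> half_space.
        - laplacian u x = real n * (real n - 2) * u x powr ((real n + 2) / (real n - 2))"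
    and bdry: "\<forall>x \<in> frontier half_space - {0}. u x = 0"
    and nonremovable: "\<not> removable_at_0 u"
  shows "\<exists>U :: real \<Rightarrow> real \<Rightarrow> real.
           (\<forall>x' x\<^sub>n. (x', x\<^sub>n) \<in> closure half_space - {0} \<longrightarrow> u (x', x\<^sub>n) = U (norm x') x\<^sub>n) \<and>
           (\<forall>r>0. \<forall>x\<^sub>n>0. (\<lambda>s. U s x\<^sub>n) differentiable (at r) \<and> deriv (\<lambda>s. U s x\<^sub>n) r < 0)"
proof -
  define \<nu> :: "'m space" where "\<nu> = (0, 1)"
  have snd_eq: "x \<bullet> \<nu> = snd x" for x by (simp add: \<nu>_def inner_prod_def)
  have hs: "{x. x \<bullet> \<nu> > 0} = half_space" "{x. x \<bullet> \<nu> \<ge> 0} = closure half_space"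
    unfolding closure_half_space by (auto simp: snd_eq half_space_def)
  have op: "open (half_space :: 'm space set)"
    by (simp add: half_space_eq open_halfspace_gt)
  interpret singular_solution u \<nu> "real n * (real n - 2)" "(real n + 2) / (real n - 2)" "real n"
  proof
    show "continuous_on ({x. x \<bullet> \<nu> \<ge> 0} - {0}) u" using cont by (simp add: hs)
    show "u x \<ge> 0" if "x \<bullet> \<nu> \<ge> 0" "x \<noteq> 0" for x
      using nonneg that by (auto simp: closure_half_space snd_eq)
    show "u x = 0" if "x \<bullet> \<nu> = 0" "x \<noteq> 0" for x
      using bdry that by (auto simp: frontier_half_space snd_eq)
    show "\<exists>d. has_lap u d (- (real n * (real n - 2)) * u x powr ((real n + 2) / (real n - 2))) x"
      if "x \<bullet> \<nu> > 0" for x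
    proof -
      have x: "x \<in> half_space" using that hs by blast
      then have "laplacian u x = - (real n * (real n - 2)) * u x powr ((real n + 2) / (real n - 2))"
        unfolding mult_minus_left bspec[OF pde x, symmetric] by simp
      then show ?thesis using laplacian_Ck_on[OF C2 x op] by simp
    qed
    show "\<not> (u \<longlongrightarrow> 0) (at 0 within {x. x \<bullet> \<nu> > 0})"
      unfolding hs by (rule not_removable_imp_not_tendsto_0[OF cont bdry nonremovable])
  qed (use n_def n_ge in \<open>auto simp: \<nu>_def norm_prod_def\<close>)
  \<comment> \<open>An arbitrary direction; the profile \<open>U\<close> is \<open>u\<close> along
    the ray through \<open>b\<close>.\<close>
  obtain b :: "real ^ 'm" where "b \<in> Basis" using nonempty_Basis by blast
  then have b: "norm b = 1" by simp
  define U where "U s x\<^sub>n = u (s *\<^sub>R b, x\<^sub>n)" for s x\<^sub>n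
  have sym: "u (x', x\<^sub>n) = U (norm x') x\<^sub>n" if x: "(x', x\<^sub>n) \<in> closure half_space - {0}" for x' x\<^sub>n
  proof (cases "x\<^sub>n = 0")
    \<comment> \<open>\<open>reflection_eq\<close> covers the open half space; on the boundary both
      sides are the boundary value 0.\<close>
    case True
    then have "x' \<noteq> 0" using x by (auto simp: zero_prod_def)
    moreover from this have "norm x' *\<^sub>R b \<noteq> 0" using b by auto
    ultimately show ?thesis
      using bdry[of "(x', 0)"] bdry[of "(norm x' *\<^sub>R b, 0)"] True
      by (simp add: U_def snd_eq zero_prod_def)
  next
    case False
    then have xn: "x\<^sub>n > 0" using x by (simp add: closure_half_space)
    \<comment> \<open>\<open>x'\<close> and \<open>norm x' *\<^sub>R b\<close> have equal norm, so
      the reflection in the hyperplane orthogonal to their difference exchanges them.\<close>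
    define w where "w = x' - norm x' *\<^sub>R b"
    show ?thesis
    proof (cases "w = 0")
      case True
      then show ?thesis by (simp add: w_def U_def)
    next
      case False
      define e :: "'m space" where "e = (w /\<^sub>R norm w, 0)"
      have bb: "b \<bullet> b = 1" using b by (simp add: dot_square_norm)
      have e: "norm e = 1" "e \<bullet> \<nu> = 0" using False by (auto simp: e_def snd_eq norm_prod_def)
      have ww: "w \<bullet> w = 2 * (x' \<bullet> w)"
      proof -
        have "w \<bullet> w = x' \<bullet> x' - 2 * (norm x' * (x' \<bullet> b)) + norm x' * norm x' * (b \<bullet> b)"
          by (simp add: w_def inner_diff_left inner_diff_right inner_commute[of b x'] right_diff_distrib)
        moreover have "x' \<bullet> w = x' \<bullet> x' - norm x' * (x' \<bullet> b)"
          by (simp add: w_def inner_diff_right)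
        moreover have "x' \<bullet> x' = norm x' * norm x'"
          by (simp only: dot_square_norm power2_eq_square)
        ultimately show ?thesis unfolding bb by linarith
      qed
      have "(2 * (x' \<bullet> w) / (norm w * norm w)) = 1"
        using False unfolding ww[symmetric] dot_square_norm power2_eq_square by simp
      then have "mirror e 0 (x', x\<^sub>n) = (x' - w, x\<^sub>n)"
        by (simp add: mirror_def e_def inner_prod_def divide_inverse mult.assoc mult.left_commute)
      then have "mirror e 0 (x', x\<^sub>n) = (norm x' *\<^sub>R b, x\<^sub>n)" by (simp add: w_def)
      then show ?thesis
        using reflection_eq[OF e, of "(x', x\<^sub>n)"] xn by (simp add: snd_eq U_def)
    qed
  qed
  have der: "(\<lambda>s. U s x\<^sub>n) differentiable (at r) \<and> deriv (\<lambda>s. U s x\<^sub>n) r < 0"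
    if r: "r > 0" and xn: "x\<^sub>n > 0" for r x\<^sub>n
  proof -
    define e :: "'m space" where "e = (b, 0)"
    define y where "y = (r *\<^sub>R b, x\<^sub>n)"
    have bb: "b \<bullet> b = 1" using b by (simp add: dot_square_norm)
    have e: "norm e = 1" "e \<bullet> \<nu> = 0" using b by (auto simp: e_def snd_eq norm_prod_def)
    have y: "y \<bullet> \<nu> > 0" "y \<bullet> e > 0"
      using r xn bb by (simp add: y_def snd_eq, simp add: y_def e_def inner_prod_def)
    obtain d where d: "(u has_derivative (\<lambda>h. d \<bullet> h)) (at y)"
      using pde[OF y(1)] has_lap_has_derivative by blast
    have line: "((\<lambda>s. y + s *\<^sub>R e) has_derivative (\<lambda>h. h *\<^sub>R e)) (at 0)"
      by (auto intro!: derivative_eq_intros)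
    have "((\<lambda>s. u (y + s *\<^sub>R e)) has_derivative (\<lambda>h. d \<bullet> (h *\<^sub>R e))) (at 0)"
      by (rule has_derivative_compose[OF line]) (simp add: d)
    then have D: "((\<lambda>s. u (y + s *\<^sub>R e)) has_real_derivative d \<bullet> e) (at 0)"
      by (simp add: has_field_derivative_def mult.commute[of _ "d \<bullet> e"])
    then have "d \<bullet> e < 0" by (rule derivative_neg[OF e y])
    moreover have "u (y + s *\<^sub>R e) = U (s + r) x\<^sub>n" for s
      by (simp add: U_def y_def e_def scaleR_add_left add.commute)
    then have "((\<lambda>s. U s x\<^sub>n) has_real_derivative d \<bullet> e) (at r)"
      using D DERIV_shift[of "\<lambda>s. U s x\<^sub>n" "d \<bullet> e" 0 r] by simp
    ultimately show ?thesis
      by (auto simp: DERIV_imp_deriv real_differentiable_def)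
  qed
  show ?thesis using sym der by blast
qed

end
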